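(* In a periagroup $\Pi=\Pi(\Gamma,\lambda,\mathcal{G})$, the intersection of any two parabolic subgroups is again a parabolic subgroup.
   Context: Let $\Gamma$ be a simplicial graph (possibly infinite), $\lambda:E(\Gamma)\to\mathbb{N}_{\geq 2}$ a labelling of its edges, and $\mathcal{G}=\{G_u\mid u\in V(\Gamma)\}$ a collection of groups indexed by the vertices of $\Gamma$ (the vertex-groups) such that for every edge $\{u,v\}$, if $\lambda(u,v)>2$ then $G_u,G_v$ have order two. The periagroup $\Pi(\Gamma,\lambda,\mathcal{G})$ is the quotient of the free product of the $G_u$ by the relations $\langle a,b\rangle^{\lambda(u,v)}=\langle b,a\rangle^{\lambda(u,v)}$ for all $\{u,v\}\in E(\Gamma)$ and all non-trivial $a\in G_u$, $b\in G_v$, where $\langle a,b\rangle^k$ is the word formed by the first $k$ letters of $ababab\cdots$. For a (possibly empty) subgraph $\Xi\leq\Gamma$, $\langle\Xi\rangle$ denotes the subgroup of $\Pi$ generated by the vertex-groups indexed by the vertices of $\Xi$. A subgroup $H\leq\Pi$ is parabolic if there exist a subgraph $\Xi\leq\Gamma$ and $g\in\Pi$ with $H=g\langle\Xi\rangle g^{-1}$. *)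

theory Defs
  imports "HOL.Hull" "HOL-Algebra.Generated_Groups"
begin

section \<open>Labelled graphs of groups\<close>

locale simplicial_graph =
  fixes V :: "'v set" and E :: "'v set set"
  assumes edge_subset: "e \<in> E \<Longrightarrow> e \<subseteq> V"
    and edge_card: "e \<in> E \<Longrightarrow> card e = 2"

text \<open>
  The subgraph need not be induced, but only its vertices matter for the subgroup it generates.
\<close>

definition subgraph :: "'v set \<Rightarrow> 'v set set \<Rightarrow> 'v set \<Rightarrow> 'v set set \<Rightarrow> bool" where
  "subgraph W F V E \<longleftrightarrow> W \<subseteq> V \<and> F \<subseteq> E \<and> simplicial_graph W F"

text \<open>
  All vertex-groups share one type of elements; this is no restriction, since that type may be
  taken to be a disjoint union. The values of \<open>lab\<close> outside \<open>E\<close> and of \<open>G\<close> outside \<open>V\<close> play no role.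
\<close>

locale periagroup_data = simplicial_graph V E
  for V :: "'v set" and E :: "'v set set" +
  fixes lab :: "'v set \<Rightarrow> nat" and G :: "'v \<Rightarrow> ('a, 'b) monoid_scheme"
  assumes lab_ge_2: "e \<in> E \<Longrightarrow> lab e \<ge> 2"
    and vertex_group: "u \<in> V \<Longrightarrow> group (G u)"
    and order_two: "\<lbrakk>e \<in> E; lab e > 2; u \<in> e\<rbrakk> \<Longrightarrow> order (G u) = 2"


section \<open>Free products\<close>

text \<open>
  A letter \<open>(u, a)\<close> stands for the element \<open>a\<close> of the vertex-group \<open>G u\<close>. The free product consists
  of the words in these letters, modulo multiplying neighbouring letters of the same vertex-group
  and deleting neutral elements.
\<close>

definition fp_words :: "'v set \<Rightarrow> ('v \<Rightarrow> ('a, 'b) monoid_scheme) \<Rightarrow> ('v \<times> 'a) list set" where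
  "fp_words V G = lists (SIGMA u:V. carrier (G u))"

inductive fp_eq :: "'v set \<Rightarrow> ('v \<Rightarrow> ('a, 'b) monoid_scheme)
    \<Rightarrow> ('v \<times> 'a) list \<Rightarrow> ('v \<times> 'a) list \<Rightarrow> bool"
  for V G where
  refl: "w \<in> fp_words V G \<Longrightarrow> fp_eq V G w w"
| sym: "fp_eq V G w w' \<Longrightarrow> fp_eq V G w' w"
| trans: "fp_eq V G w w' \<Longrightarrow> fp_eq V G w' w'' \<Longrightarrow> fp_eq V G w w''"
| mult: "\<lbrakk>x \<in> fp_words V G; y \<in> fp_words V G; u \<in> V; a \<in> carrier (G u); b \<in> carrier (G u)\<rbrakk>
    \<Longrightarrow> fp_eq V G (x @ [(u, a), (u, b)] @ y) (x @ [(u, a \<otimes>\<^bsub>G u\<^esub> b)] @ y)"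
| one: "\<lbrakk>x \<in> fp_words V G; y \<in> fp_words V G; u \<in> V\<rbrakk>
    \<Longrightarrow> fp_eq V G (x @ [(u, \<one>\<^bsub>G u\<^esub>)] @ y) (x @ y)"

definition fp_rel :: "'v set \<Rightarrow> ('v \<Rightarrow> ('a, 'b) monoid_scheme) \<Rightarrow> ('v \<times> 'a) list rel" where
  "fp_rel V G = {(w, w'). fp_eq V G w w'}"

definition fp_class :: "'v set \<Rightarrow> ('v \<Rightarrow> ('a, 'b) monoid_scheme)
    \<Rightarrow> ('v \<times> 'a) list \<Rightarrow> ('v \<times> 'a) list set" where
  "fp_class V G w = fp_rel V G `` {w}"

definition free_product :: "'v set \<Rightarrow> ('v \<Rightarrow> ('a, 'b) monoid_scheme)
    \<Rightarrow> ('v \<times> 'a) list set monoid" where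
  "free_product V G =
     \<lparr>carrier = fp_words V G // fp_rel V G,
      mult = (\<lambda>A B. \<Union>x\<in>A. \<Union>y\<in>B. fp_class V G (x @ y)),
      one = fp_class V G []\<rparr>"


section \<open>Periagroups\<close>

fun alternating :: "nat \<Rightarrow> 'c \<Rightarrow> 'c \<Rightarrow> 'c list" where
  "alternating 0 a b = []"
| "alternating (Suc k) a b = a # alternating k b a"

definition periagroup_relators :: "'v set \<Rightarrow> 'v set set \<Rightarrow> ('v set \<Rightarrow> nat)
    \<Rightarrow> ('v \<Rightarrow> ('a, 'b) monoid_scheme) \<Rightarrow> ('v \<times> 'a) list set set" where
  "periagroup_relators V E lab G =
     {fp_class V G (alternating (lab {u, v}) (u, a) (v, b)) \<otimes>\<^bsub>free_product V G\<^esub>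
        inv\<^bsub>free_product V G\<^esub> (fp_class V G (alternating (lab {u, v}) (v, b) (u, a))) | u v a b.
      {u, v} \<in> E \<and> a \<in> carrier (G u) - {\<one>\<^bsub>G u\<^esub>} \<and> b \<in> carrier (G v) - {\<one>\<^bsub>G v\<^esub>}}"

definition normal_closure :: "('c, 'd) monoid_scheme \<Rightarrow> 'c set \<Rightarrow> 'c set" where
  "normal_closure K R = (\<lambda>N. N \<lhd> K) hull R"

definition periagroup_kernel :: "'v set \<Rightarrow> 'v set set \<Rightarrow> ('v set \<Rightarrow> nat)
    \<Rightarrow> ('v \<Rightarrow> ('a, 'b) monoid_scheme) \<Rightarrow> ('v \<times> 'a) list set set" where
  "periagroup_kernel V E lab G = normal_closure (free_product V G) (periagroup_relators V E lab G)"

definition periagroup :: "'v set \<Rightarrow> 'v set set \<Rightarrow> ('v set \<Rightarrow> nat)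
    \<Rightarrow> ('v \<Rightarrow> ('a, 'b) monoid_scheme) \<Rightarrow> ('v \<times> 'a) list set set monoid" where
  "periagroup V E lab G = free_product V G Mod periagroup_kernel V E lab G"

definition vertex_elem :: "'v set \<Rightarrow> 'v set set \<Rightarrow> ('v set \<Rightarrow> nat)
    \<Rightarrow> ('v \<Rightarrow> ('a, 'b) monoid_scheme) \<Rightarrow> 'v \<Rightarrow> 'a \<Rightarrow> ('v \<times> 'a) list set set" where
  "vertex_elem V E lab G u a =
     periagroup_kernel V E lab G #>\<^bsub>free_product V G\<^esub> fp_class V G [(u, a)]"

definition vertices_subgroup :: "'v set \<Rightarrow> 'v set set \<Rightarrow> ('v set \<Rightarrow> nat)
    \<Rightarrow> ('v \<Rightarrow> ('a, 'b) monoid_scheme) \<Rightarrow> 'v set \<Rightarrow> ('v \<times> 'a) list set set set" where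
  "vertices_subgroup V E lab G W =
     generate (periagroup V E lab G) (\<Union>u\<in>W. vertex_elem V E lab G u ` carrier (G u))"

definition parabolic :: "'v set \<Rightarrow> 'v set set \<Rightarrow> ('v set \<Rightarrow> nat)
    \<Rightarrow> ('v \<Rightarrow> ('a, 'b) monoid_scheme) \<Rightarrow> ('v \<times> 'a) list set set set \<Rightarrow> bool" where
  "parabolic V E lab G H \<longleftrightarrow>
     (\<exists>W F g. subgraph W F V E \<and> g \<in> carrier (periagroup V E lab G) \<and>
        H = g <#\<^bsub>periagroup V E lab G\<^esub>
              (vertices_subgroup V E lab G W #>\<^bsub>periagroup V E lab G\<^esub> inv\<^bsub>periagroup V E lab G\<^esub> g))"


section \<open>Well-definedness\<close>

lemma fp_eq_words: "fp_eq V G w w' \<Longrightarrow> (\<forall>u\<in>V. group (G u)) \<Longrightarrow> w \<in> fp_words V G \<and> w' \<in> fp_words V G"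
  by (induction rule: fp_eq.induct)
     (auto simp: fp_words_def intro: monoid.m_closed monoid.one_closed group.is_monoid)

lemma fp_words_append [simp]:
  "x @ y \<in> fp_words V G \<longleftrightarrow> x \<in> fp_words V G \<and> y \<in> fp_words V G"
  by (auto simp: fp_words_def)

lemma fp_eq_context:
  "fp_eq V G w w' \<Longrightarrow> p \<in> fp_words V G \<Longrightarrow> q \<in> fp_words V G \<Longrightarrow> fp_eq V G (p @ w @ q) (p @ w' @ q)"
proof (induction rule: fp_eq.induct)
  case (mult x y u a b)
  then show ?case using fp_eq.mult[of "p @ x" V G "y @ q" u a b] by simp
next
  case (one x y u)
  then show ?case using fp_eq.one[of "p @ x" V G "y @ q" u] by simp
qed (auto intro: fp_eq.intros)

context
  fixes V :: "'v set" and G :: "'v \<Rightarrow> ('a, 'b) monoid_scheme"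
  assumes groups: "\<forall>u\<in>V. group (G u)"
begin

lemma fp_eq_append:
  assumes "fp_eq V G x x'" "fp_eq V G y y'"
  shows "fp_eq V G (x @ y) (x' @ y')"
proof -
  have w: "x' \<in> fp_words V G" "y \<in> fp_words V G"
    using assms fp_eq_words groups by blast+
  have "fp_eq V G (x @ y) (x' @ y)"
    using fp_eq_context[OF assms(1), of "[]" y] w by (simp add: fp_words_def)
  moreover have "fp_eq V G (x' @ y) (x' @ y')"
    using fp_eq_context[OF assms(2), of x' "[]"] w by (simp add: fp_words_def)
  ultimately show ?thesis by (rule fp_eq.trans)
qed

lemma equiv_fp_rel: "equiv (fp_words V G) (fp_rel V G)"
proof (rule equivI)
  show "fp_rel V G \<subseteq> fp_words V G \<times> fp_words V G"
    using fp_eq_words[OF _ groups] by (auto simp: fp_rel_def)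
  show "refl_on (fp_words V G) (fp_rel V G)"
    by (rule refl_onI) (simp add: fp_rel_def fp_eq.refl)
  show "sym (fp_rel V G)"
    by (rule symI) (simp add: fp_rel_def fp_eq.sym)
  show "trans (fp_rel V G)"
    by (rule transI) (simp add: fp_rel_def, rule fp_eq.trans)
qed

lemma fp_class_eq_iff:
  assumes "x \<in> fp_words V G" "y \<in> fp_words V G"
  shows "fp_class V G x = fp_class V G y \<longleftrightarrow> fp_eq V G x y"
  using eq_equiv_class_iff[OF equiv_fp_rel assms] by (simp add: fp_class_def fp_rel_def)

lemma fp_carrier: "carrier (free_product V G) = fp_class V G ` fp_words V G"
  by (auto simp: free_product_def quotient_def fp_class_def)

lemma fp_mult:
  assumes "x \<in> fp_words V G" "y \<in> fp_words V G"
  shows "fp_class V G x \<otimes>\<^bsub>free_product V G\<^esub> fp_class V G y = fp_class V G (x @ y)"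
proof -
  have eq: "fp_class V G (x' @ y') = fp_class V G (x @ y)"
    if "x' \<in> fp_class V G x" "y' \<in> fp_class V G y" for x' y'
  proof -
    have "fp_eq V G x x'" "fp_eq V G y y'"
      using that by (auto simp: fp_class_def fp_rel_def)
    then show ?thesis
      using assms fp_eq_append fp_eq_words[OF _ groups] fp_class_eq_iff
      by (metis fp_words_append)
  qed
  have mem: "x \<in> fp_class V G x" "y \<in> fp_class V G y"
    using assms by (auto simp: fp_class_def fp_rel_def intro: fp_eq.refl)
  have "fp_class V G x \<otimes>\<^bsub>free_product V G\<^esub> fp_class V G y =
      (\<Union>x'\<in>fp_class V G x. \<Union>y'\<in>fp_class V G y. fp_class V G (x' @ y'))"
    by (simp add: free_product_def)
  also have "\<dots> = (\<Union>x'\<in>fp_class V G x. \<Union>y'\<in>fp_class V G y. fp_class V G (x @ y))"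
    by (intro SUP_cong eq) simp_all
  also have "\<dots> = fp_class V G (x @ y)"
    using mem by blast
  finally show ?thesis .
qed

lemma fp_left_inverse:
  assumes "w \<in> fp_words V G"
  shows "\<exists>w' \<in> fp_words V G. fp_eq V G (w' @ w) []"
  using assms
proof (induction w)
  case Nil
  then show ?case by (auto intro!: bexI[of _ "[]"] fp_eq.refl)
next
  case (Cons l w)
  obtain u a where l: "l = (u, a)" by force
  from Cons.prems l have ua: "u \<in> V" "a \<in> carrier (G u)" and w: "w \<in> fp_words V G"
    by (auto simp: fp_words_def)
  interpret group "G u" using groups ua by blast
  obtain w' where w': "w' \<in> fp_words V G" "fp_eq V G (w' @ w) []"
    using Cons.IH w by blast
  let ?i = "(u, inv\<^bsub>G u\<^esub> a)"
  have "fp_eq V G (w' @ [?i, (u, a)] @ w) (w' @ [(u, \<one>\<^bsub>G u\<^esub>)] @ w)"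
    using fp_eq.mult[of w' V G w u "inv\<^bsub>G u\<^esub> a" a] w' w ua by simp
  moreover have "fp_eq V G (w' @ [(u, \<one>\<^bsub>G u\<^esub>)] @ w) (w' @ w)"
    using w' w ua by (intro fp_eq.one)
  ultimately have "fp_eq V G ((w' @ [?i]) @ l # w) []"
    using w'(2) l by (auto intro: fp_eq.trans)
  moreover have "w' @ [?i] \<in> fp_words V G"
    using w' ua by (auto simp: fp_words_def)
  ultimately show ?case by blast
qed

lemma group_free_product: "group (free_product V G)"
proof (rule groupI)
  have nil: "[] \<in> fp_words V G" by (simp add: fp_words_def)
  have one: "\<one>\<^bsub>free_product V G\<^esub> = fp_class V G []" by (simp add: free_product_def)
  show "\<one>\<^bsub>free_product V G\<^esub> \<in> carrier (free_product V G)"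
    using nil by (simp add: one fp_carrier)
  fix x assume "x \<in> carrier (free_product V G)"
  then obtain w where w: "w \<in> fp_words V G" "x = fp_class V G w" by (auto simp: fp_carrier)
  show "\<one>\<^bsub>free_product V G\<^esub> \<otimes>\<^bsub>free_product V G\<^esub> x = x"
    using w nil by (simp add: one fp_mult)
  show "\<exists>y\<in>carrier (free_product V G). y \<otimes>\<^bsub>free_product V G\<^esub> x = \<one>\<^bsub>free_product V G\<^esub>"
  proof -
    obtain w' where "w' \<in> fp_words V G" "fp_eq V G (w' @ w) []"
      using fp_left_inverse w by blast
    then show ?thesis
      using w nil by (auto simp: one fp_carrier fp_mult fp_class_eq_iff)
  qed
next
  fix x y assume "x \<in> carrier (free_product V G)" "y \<in> carrier (free_product V G)"
  then show "x \<otimes>\<^bsub>free_product V G\<^esub> y \<in> carrier (free_product V G)"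
    by (auto simp: fp_carrier fp_mult)
next
  fix x y z
  assume "x \<in> carrier (free_product V G)" "y \<in> carrier (free_product V G)"
    "z \<in> carrier (free_product V G)"
  then show "x \<otimes>\<^bsub>free_product V G\<^esub> y \<otimes>\<^bsub>free_product V G\<^esub> z =
      x \<otimes>\<^bsub>free_product V G\<^esub> (y \<otimes>\<^bsub>free_product V G\<^esub> z)"
    by (auto simp: fp_carrier fp_mult)
qed

end

lemma normal_normal_closure:
  assumes "group K" "R \<subseteq> carrier K"
  shows "normal_closure K R \<lhd> K"
proof -
  interpret group K by fact
  let ?\<N> = "{N. N \<lhd> K \<and> R \<subseteq> N}"
  have "carrier K \<lhd> K"
    unfolding normal_inv_iff by (intro conjI ballI subgroup_self m_closed inv_closed)
  then have ne: "?\<N> \<noteq> {}" using assms(2) by (intro ex_in_conv[THEN iffD1] exI[of _ "carrier K"]) simp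
  have sub: "subgroup (\<Inter>?\<N>) K"
  proof (rule subgroups_Inter[OF _ ne])
    show "subgroup N K" if "N \<in> ?\<N>" for N
      using that by (simp add: normal_imp_subgroup)
  qed
  have conj: "g \<otimes>\<^bsub>K\<^esub> h \<otimes>\<^bsub>K\<^esub> inv\<^bsub>K\<^esub> g \<in> \<Inter>?\<N>"
    if "g \<in> carrier K" "h \<in> \<Inter>?\<N>" for g h
  proof (rule InterI)
    fix N assume N: "N \<in> ?\<N>"
    with that(2) have "h \<in> N" by (rule InterD)
    with N that(1) show "g \<otimes>\<^bsub>K\<^esub> h \<otimes>\<^bsub>K\<^esub> inv\<^bsub>K\<^esub> g \<in> N"
      by (simp add: normal.inv_op_closed2)
  qed
  show ?thesis
    unfolding normal_closure_def hull_def normal_inv_iff[of "\<Inter>?\<N>"]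
    by (intro conjI ballI sub conj)
qed

context periagroup_data
begin

lemma alternating_words:
  assumes "{u, v} \<in> E" "a \<in> carrier (G u)" "b \<in> carrier (G v)"
  shows "alternating k (u, a) (v, b) \<in> fp_words V G"
proof -
  have "set (alternating k x y) \<subseteq> {x, y}" for x y :: "'v \<times> 'a"
    by (induction k arbitrary: x y) (simp_all, blast)
  moreover have "u \<in> V" "v \<in> V" using edge_subset assms by auto
  ultimately show ?thesis using assms by (fastforce simp: fp_words_def)
qed

lemma relators_subset: "periagroup_relators V E lab G \<subseteq> carrier (free_product V G)"
proof -
  have gr: "\<forall>u\<in>V. group (G u)" by (simp add: vertex_group)
  interpret group "free_product V G" by (rule group_free_product[OF gr])
  have cl: "fp_class V G (alternating k (u, a) (v, b)) \<in> carrier (free_product V G)"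
    if "{u, v} \<in> E" "a \<in> carrier (G u)" "b \<in> carrier (G v)" for k u v a b
    using alternating_words[OF that] by (simp add: fp_carrier[OF gr])
  have cl': "fp_class V G (alternating k (v, b) (u, a)) \<in> carrier (free_product V G)"
    if "{u, v} \<in> E" "a \<in> carrier (G u)" "b \<in> carrier (G v)" for k u v a b
    using cl[of v u b a k] that by (simp add: insert_commute)
  show ?thesis
    unfolding periagroup_relators_def
    by (rule subsetI, elim CollectE exE conjE, hypsubst, intro m_closed inv_closed cl cl') simp_all
qed

lemma normal_kernel: "periagroup_kernel V E lab G \<lhd> free_product V G"
  unfolding periagroup_kernel_def
  by (intro normal_normal_closure group_free_product relators_subset) (simp add: vertex_group)

lemma group_periagroup: "group (periagroup V E lab G)"
  unfolding periagroup_def by (rule normal.factorgroup_is_group[OF normal_kernel])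

lemma vertex_elem_closed:
  assumes "u \<in> V" "a \<in> carrier (G u)"
  shows "vertex_elem V E lab G u a \<in> carrier (periagroup V E lab G)"
proof -
  have "fp_class V G [(u, a)] \<in> carrier (free_product V G)"
    using assms fp_carrier[of V G] vertex_group by (simp add: fp_words_def)
  then show ?thesis
    unfolding vertex_elem_def periagroup_def FactGroup_def RCOSETS_def by simp blast
qed

lemma subgroup_vertices_subgroup:
  "W \<subseteq> V \<Longrightarrow> subgroup (vertices_subgroup V E lab G W) (periagroup V E lab G)"
  unfolding vertices_subgroup_def
  by (rule group.generate_is_subgroup[OF group_periagroup]) (auto intro: vertex_elem_closed)

end

end

theory Submission
  imports Defs
begin

text \<open>
  Call the conjugates of the vertex-groups walls. Following a word through the Cayley graph, one
  may record for each wall \<open>T\<close> the product of the elements of \<open>T\<close> by which the word moves along it;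
  this is invariant under the defining relations (in the dihedral case both sides of a relation
  cross the same reflections, in opposite order), so it yields a cocycle \<open>N g T\<close> on the group.
  The cocycle plays the role of the inversion set of an element of a Coxeter group: \<open>N g (G u) \<noteq> \<one>\<close>
  iff \<open>g\<close> is not the unique shortest element of \<open>G u g\<close>. Hence a shortest element \<open>h\<close> of a double
  coset \<open>\<langle>X\<rangle> h \<langle>Y\<rangle>\<close> satisfies \<open>\<bar>a h\<bar> = \<bar>a\<bar> + \<bar>h\<bar>\<close> and \<open>\<bar>h b\<bar> = \<bar>h\<bar> + \<bar>b\<bar>\<close>. If \<open>a h = h b\<close>, then peeling
  letters off \<open>b\<close> gives equations \<open>r h = h t\<close> with single letters \<open>r \<in> G u\<close>, \<open>t \<in> G v\<close>, and evaluating
  the cocycle at the wall \<open>G u\<close> forces \<open>G u = h G v h\<^sup>-\<^sup>1\<close>. So \<open>\<langle>X\<rangle> \<inter> h \<langle>Y\<rangle> h\<^sup>-\<^sup>1\<close> is generated by the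
  vertex-groups \<open>G u\<close>, \<open>u \<in> X\<close>, of this form.
\<close>


section \<open>Conjugates of sets\<close>

context group
begin

definition conj_set :: "'a \<Rightarrow> 'a set \<Rightarrow> 'a set" where
  "conj_set x T = (\<lambda>t. x \<otimes> t \<otimes> inv x) ` T"

lemma conj_set_closed: "x \<in> carrier G \<Longrightarrow> T \<subseteq> carrier G \<Longrightarrow> conj_set x T \<subseteq> carrier G"
  by (auto simp: conj_set_def)

lemma conj_set_one [simp]: "T \<subseteq> carrier G \<Longrightarrow> conj_set \<one> T = T"
  by (force simp: conj_set_def image_iff subset_iff)

lemma conj_set_mult:
  assumes "x \<in> carrier G" "y \<in> carrier G" "T \<subseteq> carrier G"
  shows "conj_set (x \<otimes> y) T = conj_set x (conj_set y T)"
  unfolding conj_set_def image_image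
  by (rule image_cong) (use assms in \<open>auto simp: m_assoc inv_mult_group subset_iff\<close>)

lemma conj_set_inv_left [simp]:
  "x \<in> carrier G \<Longrightarrow> T \<subseteq> carrier G \<Longrightarrow> conj_set (inv x) (conj_set x T) = T"
  by (simp flip: conj_set_mult)

lemma conj_set_inv_right [simp]:
  "x \<in> carrier G \<Longrightarrow> T \<subseteq> carrier G \<Longrightarrow> conj_set x (conj_set (inv x) T) = T"
  by (simp flip: conj_set_mult)

lemma conj_set_subgroup:
  assumes "subgroup H G" "x \<in> H"
  shows "conj_set x H = H"
proof -
  have "conj_set y H \<subseteq> H" if "y \<in> H" for y
    using assms(1) that by (auto simp: conj_set_def subgroup.m_closed subgroup.m_inv_closed)
  \<comment> \<open>The inclusion just shown, applied to \<open>inv x\<close>, gives the reverse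
    inclusion through this identity.\<close>
  moreover have "H = conj_set x (conj_set (inv x) H)"
    using assms subgroup.mem_carrier subgroup.subset by (metis conj_set_inv_right)
  ultimately show ?thesis
    using assms by (metis conj_set_def image_mono subgroup.m_inv_closed subset_antisym)
qed

lemma conj_set_Int:
  assumes "x \<in> carrier G" "A \<subseteq> carrier G" "B \<subseteq> carrier G"
  shows "conj_set x (A \<inter> B) = conj_set x A \<inter> conj_set x B"
  unfolding conj_set_def
  by (rule inj_on_image_Int[where C = "carrier G"]) (use assms in \<open>auto intro!: inj_onI\<close>)

lemma conj_set_eq_cosets:
  assumes "x \<in> carrier G" "T \<subseteq> carrier G"
  shows "x <# (T #> inv x) = conj_set x T"
  using assms by (force simp: conj_set_def l_coset_def r_coset_def m_assoc subset_iff)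

end


section \<open>Groups with a wall cocycle\<close>

text \<open>
  A wall is a conjugate \<open>T\<close> of some \<open>S u\<close>, and \<open>N g T\<close> is the total displacement along \<open>T\<close>
  of any path from \<open>\<one>\<close> to \<open>g\<close> in the Cayley graph; it is meaningful for walls only.
\<close>

locale wall_cocycle = group P for P (structure) +
  fixes I :: "'i set" and S :: "'i \<Rightarrow> 'a set" and N :: "'a \<Rightarrow> 'a set \<Rightarrow> 'a"
  assumes subgroup_S: "u \<in> I \<Longrightarrow> subgroup (S u) P"
    and generate_S: "generate P (\<Union>u\<in>I. S u) = carrier P"
    and N_closed: "\<lbrakk>g \<in> carrier P; T \<subseteq> carrier P\<rbrakk> \<Longrightarrow> N g T \<in> carrier P"
    and N_mult: "\<lbrakk>x \<in> carrier P; y \<in> carrier P; T \<subseteq> carrier P\<rbrakk>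
      \<Longrightarrow> N (x \<otimes> y) T = x \<otimes> N y (conj_set (inv x) T) \<otimes> inv x \<otimes> N x T"
    and N_generator: "\<lbrakk>u \<in> I; s \<in> S u; T \<subseteq> carrier P\<rbrakk> \<Longrightarrow> N s T = (if T = S u then s else \<one>)"
begin

section \<open>Spans, words and syllable length\<close>

definition span :: "'i set \<Rightarrow> 'a set" where
  "span X = generate P (\<Union>u\<in>X. S u)"

text \<open>A whole element of some \<open>S u\<close> counts as one letter, so the length built on
  this is syllable length. Neutral letters are allowed, which spares side conditions and does not
  affect the minimum.\<close>

inductive has_word :: "'i set \<Rightarrow> nat \<Rightarrow> 'a \<Rightarrow> bool" for X where
  Nil: "has_word X 0 \<one>"
| Cons: "has_word X n g \<Longrightarrow> u \<in> X \<Longrightarrow> s \<in> S u \<Longrightarrow> has_word X (Suc n) (s \<otimes> g)"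

text \<open>The alphabet is a parameter because the exchange argument has to stay inside a given
  span; \<open>len_span\<close> shows later that the value on \<open>span X\<close> agrees with that
  of \<open>len I\<close>.\<close>

definition len :: "'i set \<Rightarrow> 'a \<Rightarrow> nat" where
  "len X g = (LEAST n. has_word X n g)"

lemma S_subset: "u \<in> I \<Longrightarrow> S u \<subseteq> carrier P"
  by (rule subgroup.subset[OF subgroup_S])

lemma S_carrier: "u \<in> I \<Longrightarrow> s \<in> S u \<Longrightarrow> s \<in> carrier P"
  using S_subset by blast

lemma span_I: "span I = carrier P"
  by (simp add: span_def generate_S)

lemma subgroup_span: "X \<subseteq> I \<Longrightarrow> subgroup (span X) P"
  unfolding span_def by (rule generate_is_subgroup) (use S_subset in blast)

lemma span_subset: "X \<subseteq> I \<Longrightarrow> span X \<subseteq> carrier P"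
  by (rule subgroup.subset[OF subgroup_span])

lemma S_span: "u \<in> X \<Longrightarrow> S u \<subseteq> span X"
  unfolding span_def by (auto intro: generate.incl)

lemma span_mono: "X \<subseteq> Y \<Longrightarrow> span X \<subseteq> span Y"
  unfolding span_def by (rule mono_generate) auto

lemma has_word_span: "has_word X n g \<Longrightarrow> X \<subseteq> I \<Longrightarrow> g \<in> span X"
proof (induction rule: has_word.induct)
  case Nil
  then show ?case by (simp add: subgroup.one_closed subgroup_span)
next
  case (Cons n g u s)
  then show ?case using S_span subgroup.m_closed[OF subgroup_span] by blast
qed

lemma has_word_mult:
  assumes "has_word X m x" "has_word X n y" "X \<subseteq> I"
  shows "has_word X (m + n) (x \<otimes> y)"
  using assms(1)
proof (induction rule: has_word.induct)
  case Nil
  have "y \<in> carrier P" using has_word_span[OF assms(2,3)] span_subset[OF assms(3)] by blast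
  then show ?case using assms(2) by simp
next
  case (Cons k g u s)
  have "g \<in> carrier P" "s \<in> carrier P" "y \<in> carrier P"
    using Cons has_word_span assms span_subset S_carrier by blast+
  then show ?case using has_word.Cons[OF Cons.IH Cons.hyps(2,3)] by (simp add: m_assoc)
qed

lemma has_word_generator: "u \<in> X \<Longrightarrow> X \<subseteq> I \<Longrightarrow> s \<in> S u \<Longrightarrow> has_word X 1 s"
  using has_word.Cons[OF has_word.Nil, of u X s] S_carrier[of u s] by auto

lemma has_word_inv: "has_word X n g \<Longrightarrow> X \<subseteq> I \<Longrightarrow> has_word X n (inv g)"
proof (induction rule: has_word.induct)
  case Nil
  then show ?case by (simp add: has_word.Nil)
next
  case (Cons n g u s)
  have "g \<in> carrier P" "s \<in> carrier P"
    using Cons has_word_span span_subset S_carrier by blast+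
  moreover have "has_word X 1 (inv s)"
    using Cons by (meson has_word_generator subgroup.m_inv_closed subgroup_S subsetD)
  ultimately show ?case
    using has_word_mult[of X n "inv g" 1 "inv s"] Cons by (simp add: inv_mult_group)
qed

lemma span_has_word:
  assumes "X \<subseteq> I" "g \<in> span X"
  shows "\<exists>n. has_word X n g"
  using assms(2) unfolding span_def
proof (induction rule: generate.induct)
  case one
  then show ?case using has_word.Nil by blast
next
  case (incl h)
  then show ?case using has_word_generator assms(1) by blast
next
  case (inv h)
  then show ?case using has_word_generator has_word_inv assms(1) by blast
next
  case (eng h1 h2)
  then show ?case using has_word_mult assms(1) by blast
qed

lemma has_word_len: "X \<subseteq> I \<Longrightarrow> g \<in> span X \<Longrightarrow> has_word X (len X g) g"
  unfolding len_def using span_has_word by (meson LeastI_ex)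

lemma len_le: "has_word X n g \<Longrightarrow> len X g \<le> n"
  unfolding len_def by (rule Least_le)

lemma len_one [simp]: "len X \<one> = 0"
  using len_le[OF has_word.Nil] by simp

lemma len_mult_generator:
  "\<lbrakk>X \<subseteq> I; u \<in> X; s \<in> S u; g \<in> span X\<rbrakk> \<Longrightarrow> len X (s \<otimes> g) \<le> Suc (len X g)"
  by (intro len_le has_word.Cons has_word_len)

text \<open>Removing the first letter of a shortest word leaves a shortest word, since otherwise
  putting the letter back would shorten the original.\<close>

lemma len_cases:
  assumes "X \<subseteq> I" "g \<in> span X" "g \<noteq> \<one>"
  obtains u s g' where "u \<in> X" "s \<in> S u" "g' \<in> span X" "g = s \<otimes> g'" "len X g = Suc (len X g')"
  using has_word_len[OF assms(1,2)]
proof (cases rule: has_word.cases)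
  case Nil
  then show ?thesis using assms by simp
next
  case (Cons n g' u s)
  have g': "g' \<in> span X" using Cons has_word_span assms by blast
  have "len X g \<le> Suc (len X g')"
    using len_mult_generator[OF assms(1) Cons(4,5) g'] Cons(2) by simp
  moreover have "len X g' \<le> n" using Cons len_le by blast
  ultimately have "len X g = Suc (len X g')" using Cons(1) by linarith
  then show ?thesis using that Cons g' by blast
qed

lemma len_inv:
  assumes "g \<in> carrier P"
  shows "len I (inv g) = len I g"
proof -
  have "len I (inv x) \<le> len I x" if "x \<in> carrier P" for x
    using that by (intro len_le has_word_inv has_word_len) (auto simp: span_I)
  from this[of g] this[of "inv g"] assms show ?thesis by simp
qed

section \<open>How the cocycle controls length\<close>

lemma N_one: "T \<subseteq> carrier P \<Longrightarrow> N \<one> T = \<one>"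
  using N_mult[of \<one> \<one> T] N_closed[of \<one> T] by (simp add: r_cancel_one')

text \<open>Conjugation by \<open>s\<close> fixes the wall \<open>S u\<close>, and the trailing
  \<open>inv s\<close> of the cocycle rule cancels against the contribution of
  \<open>s\<close>.\<close>

lemma N_mult_generator:
  assumes "u \<in> I" "s \<in> S u" "g \<in> carrier P"
  shows "N (s \<otimes> g) (S u) = s \<otimes> N g (S u)"
proof -
  have s: "s \<in> carrier P" using assms S_carrier by blast
  have "conj_set (inv s) (S u) = S u"
    using assms conj_set_subgroup subgroup_S subgroup.m_inv_closed by metis
  then have "N (s \<otimes> g) (S u) = s \<otimes> N g (S u) \<otimes> inv s \<otimes> s"
    using N_mult[OF s assms(3), of "S u"] assms S_subset N_generator by simp
  then show ?thesis using s assms N_closed S_subset by (simp add: m_assoc)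
qed

text \<open>This is the exchange condition: a shortest word for \<open>h\<close> must cross
  \<open>T\<close>, and the crossing can be removed. Write \<open>h = s h'\<close>. If
  \<open>T = S u\<close>, multiply by \<open>inv s\<close>. Otherwise \<open>s\<close> contributes
  nothing at \<open>T\<close>, so \<open>h'\<close> has nontrivial displacement along
  \<open>inv s T s\<close>; an element \<open>t'\<close> there that shortens \<open>h'\<close>
  conjugates to \<open>t = s t' inv s\<close> in \<open>T\<close>, and
  \<open>t h = s (t' h')\<close>.\<close>

lemma N_nontrivial_shortens:
  assumes "X \<subseteq> I" "h \<in> span X" "T \<subseteq> carrier P" "N h T \<noteq> \<one>"
  shows "\<exists>t\<in>T. t \<otimes> h \<in> span X \<and> len X (t \<otimes> h) < len X h"
  using assms(2-)
proof (induction "len X h" arbitrary: h T rule: less_induct)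
  case less
  have "h \<noteq> \<one>" using less.prems N_one by blast
  then obtain u s h' where d: "u \<in> X" "s \<in> S u" "h' \<in> span X" "h = s \<otimes> h'"
    "len X h = Suc (len X h')"
    using len_cases[OF assms(1) less.prems(1)] by metis
  have u: "u \<in> I" using d assms by blast
  have s: "s \<in> carrier P" using S_carrier u d by blast
  have h': "h' \<in> carrier P" using span_subset d assms by blast
  show ?case
  proof (cases "T = S u")
    case True
    then have "inv s \<in> T" using u d subgroup_S subgroup.m_inv_closed by metis
    moreover have "inv s \<otimes> h = h'" using s h' d by (simp flip: m_assoc)
    ultimately show ?thesis using d by (intro bexI[of _ "inv s"]) auto
  next
    case False
    let ?T = "conj_set (inv s) T"
    have T: "?T \<subseteq> carrier P" using s less.prems conj_set_closed by blast
    have "N h T = s \<otimes> N h' ?T \<otimes> inv s"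
      using N_mult[OF s h' less.prems(2)] N_generator[OF u d(2) less.prems(2)] False d(4)
        N_closed[OF h' T] s by simp
    then have "N h' ?T \<noteq> \<one>" using less.prems s by auto
    then obtain t' where t': "t' \<in> ?T" "t' \<otimes> h' \<in> span X" "len X (t' \<otimes> h') < len X h'"
      using less.hyps[of h' ?T] d T by auto
    then obtain t where t: "t \<in> T" "t' = inv s \<otimes> t \<otimes> s"
      using s by (auto simp: conj_set_def)
    have "t \<in> carrier P" using t less.prems by blast
    then have eq: "t \<otimes> h = s \<otimes> (t' \<otimes> h')"
      using s h' t d by (simp add: inv_solve_left m_assoc) (simp flip: m_assoc)
    have "t \<otimes> h \<in> span X"
      unfolding eq using S_span d t' subgroup_span[OF assms(1)]
      by (meson subgroup.m_closed subsetD)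
    moreover have "len X (t \<otimes> h) < len X h"
      unfolding eq using len_mult_generator[OF assms(1) d(1,2) t'(2)] t'(3) d(5) by simp
    ultimately show ?thesis using t by blast
  qed
qed

text \<open>For nontrivial \<open>c\<close> in \<open>S u\<close> the cocycle of \<open>c h\<close>
  at \<open>S u\<close> is \<open>c\<close>, so by exchange \<open>c h\<close> is not shortest in
  the coset \<open>S u h\<close>. Hence \<open>h\<close> is the unique shortest element there, and
  one letter adds at most one to the length.\<close>

lemma len_increase:
  assumes "X \<subseteq> I" "u \<in> X" "s \<in> S u" "s \<noteq> \<one>" "h \<in> span X" "N h (S u) = \<one>"
  shows "len X (s \<otimes> h) = Suc (len X h)"
proof -
  have u: "u \<in> I" using assms by blast
  note su = subgroup_S[OF u] and sp = subgroup_span[OF assms(1)]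
  have h: "h \<in> carrier P" using assms span_subset by blast
  have N: "N (c \<otimes> h) (S u) = c" if "c \<in> S u" for c
    using N_mult_generator[OF u that h] assms S_carrier u that by simp
  have mem: "c \<otimes> h \<in> span X" if "c \<in> S u" for c
    using S_span assms that sp by (meson subgroup.m_closed subsetD)
  have desc: "\<exists>t. t \<in> S u \<and> len X (t \<otimes> h) < len X (c \<otimes> h)" if c: "c \<in> S u" "c \<noteq> \<one>" for c
  proof -
    obtain t where t: "t \<in> S u" "len X (t \<otimes> (c \<otimes> h)) < len X (c \<otimes> h)"
      using N_nontrivial_shortens[OF assms(1) mem[OF c(1)] S_subset[OF u]] N[OF c(1)] c by auto
    moreover have "t \<otimes> (c \<otimes> h) = (t \<otimes> c) \<otimes> h"
      using t c h S_carrier u by (simp add: m_assoc)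
    ultimately show ?thesis using c su subgroup.m_closed by metis
  qed
  have one: "\<one> \<in> S u" using su subgroup.one_closed by blast
  \<comment> \<open>A shortest element of the coset exists; \<open>desc\<close> excludes every
    candidate except \<open>c = \<one>\<close>.\<close>
  obtain c where c: "c \<in> S u" "\<And>d. d \<in> S u \<Longrightarrow> len X (c \<otimes> h) \<le> len X (d \<otimes> h)"
    using ex_has_least_nat[of "\<lambda>c. c \<in> S u" \<one> "\<lambda>c. len X (c \<otimes> h)"] one by blast
  then have "c = \<one>" using desc leD by metis
  then have min: "len X h \<le> len X (d \<otimes> h)" if "d \<in> S u" for d
    using c(2) that h by simp
  have "len X h < len X (s \<otimes> h)"
    using desc[OF assms(3,4)] min by (meson le_less_trans)
  then show ?thesis using len_mult_generator[OF assms(1,2,3,5)] by simp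
qed

text \<open>Otherwise exchange gives a shorter \<open>t h\<close> in the same coset, and
  \<open>s h\<close> differs from it by the single letter \<open>s inv t\<close>, so it is no longer
  than \<open>h\<close>.\<close>

lemma N_trivial_if_len_increase:
  assumes "X \<subseteq> I" "u \<in> X" "s \<in> S u" "h \<in> span X" "len X (s \<otimes> h) = Suc (len X h)"
  shows "N h (S u) = \<one>"
proof (rule ccontr)
  assume "N h (S u) \<noteq> \<one>"
  have u: "u \<in> I" using assms by blast
  obtain t where t: "t \<in> S u" "t \<otimes> h \<in> span X" "len X (t \<otimes> h) < len X h"
    using N_nontrivial_shortens[OF assms(1,4) S_subset[OF u]] \<open>N h (S u) \<noteq> \<one>\<close> by blast
  have "s \<otimes> inv t \<in> S u"
    using assms t u subgroup_S by (meson subgroup.m_closed subgroup.m_inv_closed)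
  moreover have "s \<in> carrier P" "t \<in> carrier P" "h \<in> carrier P"
    using assms t u S_carrier span_subset by blast+
  then have "s \<otimes> h = (s \<otimes> inv t) \<otimes> (t \<otimes> h)"
    by (simp add: m_assoc) (simp flip: m_assoc)
  ultimately have "len X (s \<otimes> h) \<le> Suc (len X (t \<otimes> h))"
    using len_mult_generator[OF assms(1,2)] t by simp
  then show False using t assms by simp
qed

text \<open>The criterion \<open>N a' (S u) = \<one>\<close> does not mention the alphabet. It holds
  because the first letter increases \<open>len X\<close>, and it forces that letter to increase
  \<open>len I\<close> as well.\<close>

lemma len_span:
  assumes "X \<subseteq> I" "a \<in> span X"
  shows "len X a = len I a"
  using assms(2)
proof (induction "len X a" arbitrary: a rule: less_induct)
  case less
  show ?case
  proof (cases "a = \<one>")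
    case False
    then obtain u s a' where d: "u \<in> X" "s \<in> S u" "a' \<in> span X" "a = s \<otimes> a'"
      "len X a = Suc (len X a')"
      using len_cases[OF assms(1) less.prems] by metis
    have N: "N a' (S u) = \<one>"
      using N_trivial_if_len_increase[OF assms(1) d(1-3)] d by simp
    have a': "a' \<in> span I" using d span_mono assms by blast
    have "s \<noteq> \<one>" using d a' by (auto simp: span_I)
    then have "len I a = Suc (len I a')"
      using len_increase[of I u s a'] d N a' assms by auto
    then show ?thesis using less.hyps[of a'] d by simp
  qed simp
qed

lemma span_cases:
  assumes "X \<subseteq> I" "a \<in> span X" "a \<noteq> \<one>"
  obtains u s a' where "u \<in> X" "s \<in> S u" "s \<noteq> \<one>" "a' \<in> span X" "a = s \<otimes> a'"
    "len I a = Suc (len I a')" "N a' (S u) = \<one>"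
proof -
  obtain u s a' where d: "u \<in> X" "s \<in> S u" "a' \<in> span X" "a = s \<otimes> a'"
    "len X a = Suc (len X a')"
    using len_cases[OF assms] by metis
  moreover have "s \<noteq> \<one>" using d span_subset[OF assms(1)] by auto
  moreover have "N a' (S u) = \<one>"
    using N_trivial_if_len_increase[OF assms(1) d(1-3)] d by simp
  ultimately show ?thesis using that len_span assms by metis
qed

section \<open>Shortest elements of cosets of spans\<close>

definition left_minimal :: "'i set \<Rightarrow> 'a \<Rightarrow> bool" where
  "left_minimal X h \<longleftrightarrow> h \<in> carrier P \<and> (\<forall>a\<in>span X. len I h \<le> len I (a \<otimes> h))"

text \<open>By the cocycle rule the two sides differ by the displacement of \<open>h\<close> along
  \<open>inv a (S u) a\<close>. This set lies in \<open>span X\<close>, so a nontrivial displacement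
  would let an element of \<open>span X\<close> shorten \<open>h\<close>.\<close>

lemma N_left_minimal:
  assumes "X \<subseteq> I" "left_minimal X h" "a \<in> span X" "u \<in> X"
  shows "N (a \<otimes> h) (S u) = N a (S u)"
proof -
  have u: "u \<in> I" using assms by blast
  have a: "a \<in> carrier P" using assms span_subset by blast
  have h: "h \<in> carrier P" using assms by (simp add: left_minimal_def)
  let ?T = "conj_set (inv a) (S u)"
  have T: "?T \<subseteq> carrier P" using conj_set_closed a S_subset u by blast
  have "?T \<subseteq> span X"
    using a assms S_span[OF assms(4)] subgroup_span[OF assms(1)]
    by (auto simp: conj_set_def intro!: subgroup.m_closed subgroup.m_inv_closed)
  then have "N h ?T = \<one>"
    using N_nontrivial_shortens[of I h ?T] T h assms(2)
    by (force simp: span_I left_minimal_def)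
  then show ?thesis
    using N_mult[OF a h S_subset[OF u]] a N_closed[OF a S_subset[OF u]] by simp
qed

text \<open>Peel the letters of \<open>a\<close> from the left. By \<open>N_left_minimal\<close> the
  cocycle at \<open>S u\<close> is the same for \<open>a'\<close> and \<open>a' h\<close>, so a
  letter that lengthens the first lengthens the second.\<close>

lemma len_left_minimal:
  assumes "X \<subseteq> I" "left_minimal X h" "a \<in> span X"
  shows "len I (a \<otimes> h) = len I a + len I h"
  using assms(3)
proof (induction "len I a" arbitrary: a rule: less_induct)
  case less
  have h: "h \<in> carrier P" using assms by (simp add: left_minimal_def)
  show ?case
  proof (cases "a = \<one>")
    case False
    then obtain u s a' where d: "u \<in> X" "s \<in> S u" "s \<noteq> \<one>" "a' \<in> span X" "a = s \<otimes> a'"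
      "len I a = Suc (len I a')" "N a' (S u) = \<one>"
      using span_cases[OF assms(1) less.prems] by metis
    have a': "a' \<in> carrier P" "s \<in> carrier P" using d assms span_subset S_carrier by blast+
    have "N (a' \<otimes> h) (S u) = \<one>" using N_left_minimal[OF assms(1,2) d(4,1)] d by simp
    then have "len I (s \<otimes> (a' \<otimes> h)) = Suc (len I (a' \<otimes> h))"
      using len_increase[of I u s "a' \<otimes> h"] d a' h assms by (auto simp: span_I)
    then show ?thesis using less.hyps[of a'] d a' h by (simp add: m_assoc)
  qed (simp add: h)
qed

text \<open>Minimality on the right is encoded as left minimality of the inverse; inversion
  preserves \<open>len I\<close>, so the left version applies.\<close>

lemma len_right_minimal:
  assumes "Y \<subseteq> I" "left_minimal Y (inv h)" "h \<in> carrier P" "b \<in> span Y"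
  shows "len I (h \<otimes> b) = len I h + len I b"
proof -
  have b: "b \<in> carrier P" using assms span_subset by blast
  have "len I (h \<otimes> b) = len I (inv b \<otimes> inv h)"
    using len_inv[of "h \<otimes> b"] b assms by (simp add: inv_mult_group)
  also have "\<dots> = len I (inv b) + len I (inv h)"
    using assms by (intro len_left_minimal[of Y]) (auto simp: subgroup.m_inv_closed subgroup_span)
  finally show ?thesis using len_inv b assms by simp
qed

section \<open>Intersections of conjugates of spans\<close>

definition common_generators :: "'i set \<Rightarrow> 'i set \<Rightarrow> 'a \<Rightarrow> 'i set" where
  "common_generators X Y h = {u \<in> X. \<exists>v\<in>Y. S u = conj_set h (S v)}"

text \<open>Induction on the length of \<open>b\<close>. From \<open>a h = h b\<close> one extracts
  letters with \<open>r h = h t\<close> such that \<open>t b\<close> is shorter than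
  \<open>b\<close>, shows that \<open>r\<close> lies in the target span, and applies the induction
  hypothesis to \<open>(r a) h = h (t b)\<close>.\<close>

lemma minimal_intersection_subset:
  assumes "X \<subseteq> I" "Y \<subseteq> I" "left_minimal X h" "left_minimal Y (inv h)"
    and "a \<in> span X" "b \<in> span Y" "a \<otimes> h = h \<otimes> b"
  shows "a \<in> span (common_generators X Y h)"
  using assms(5-)
proof (induction "len I b" arbitrary: a b rule: less_induct)
  case less
  let ?Z = "common_generators X Y h"
  have Z: "?Z \<subseteq> I" using assms(1) by (auto simp: common_generators_def)
  have h: "h \<in> carrier P" using assms(3) by (simp add: left_minimal_def)
  have ab: "a \<in> carrier P" "b \<in> carrier P" using less.prems span_subset assms by blast+
  have spX: "subgroup (span X) P" and spY: "subgroup (span Y) P" and spZ: "subgroup (span ?Z) P"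
    using subgroup_span assms Z by blast+
  show ?case
  proof (cases "a = \<one>")
    case True
    then show ?thesis using spZ subgroup.one_closed by blast
  next
    case False
    then obtain u s a' where d: "u \<in> X" "s \<in> S u" "s \<noteq> \<one>" "a' \<in> span X" "a = s \<otimes> a'"
      "N a' (S u) = \<one>"
      using span_cases[OF assms(1) less.prems(1)] by metis
    have u: "u \<in> I" using d assms by blast
    note Su = S_subset[OF u]
    have s: "s \<in> carrier P" "a' \<in> carrier P" using d span_subset assms Su by blast+
    let ?T = "conj_set (inv h) (S u)"
    have T: "?T \<subseteq> carrier P" using conj_set_closed h Su by blast
    have Nh: "N h (S u) = \<one>"
      using N_left_minimal[OF assms(1,3) subgroup.one_closed[OF spX] d(1)] h N_one Su by simp
    have Nhb: "N (h \<otimes> x) (S u) = h \<otimes> N x ?T \<otimes> inv h" if "x \<in> carrier P" for x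
      using N_mult[OF h that Su] Nh N_closed[OF that T] h by simp
    \<comment> \<open>The first letter \<open>s\<close> of \<open>a\<close> is visible at the wall
      \<open>S u\<close>. Since \<open>h\<close> has no displacement there, the equation
      \<open>a h = h b\<close> passes this displacement on to \<open>b\<close> along
      \<open>?T\<close>.\<close>
    have "N (a \<otimes> h) (S u) = s"
      using N_left_minimal[OF assms(1,3) less.prems(1) d(1)] N_mult_generator[OF u d(2) s(2)] d s
      by simp
    then have "N b ?T \<noteq> \<one>" using Nhb[OF ab(2)] less.prems d h by auto
    then obtain t where t: "t \<in> ?T" "t \<otimes> b \<in> span Y" "len Y (t \<otimes> b) < len Y b"
      using N_nontrivial_shortens[OF assms(2) less.prems(2) T] by blast
    obtain r where r: "r \<in> S u" "t = inv h \<otimes> r \<otimes> h"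
      using t h by (auto simp: conj_set_def)
    have rt: "r \<in> carrier P" "t \<in> carrier P" using r Su t T by blast+
    have ht: "h \<otimes> t = r \<otimes> h" using r rt h by (simp add: m_assoc) (simp flip: m_assoc)
    have "t \<noteq> \<one>" using t ab by auto
    then have "r \<noteq> \<one>" using r h by auto
    have "t = (t \<otimes> b) \<otimes> inv b" using rt ab by (simp add: m_assoc)
    then have tY: "t \<in> span Y"
      using t less.prems spY by (metis subgroup.m_closed subgroup.m_inv_closed)
    have rX: "r \<in> span X" using r d S_span by blast
    \<comment> \<open>Both sides of \<open>r h = h t\<close> have additive length, so
      \<open>t\<close> is no longer than the single letter \<open>r\<close>.\<close>
    have "len I t + len I h = len I r + len I h"
      using len_right_minimal[OF assms(2,4) h tY] len_left_minimal[OF assms(1,3) rX] ht by simp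
    moreover have "len I r \<le> 1" by (rule len_le[OF has_word_generator[OF u _ r(1)]]) simp
    ultimately have "len I t \<le> 1" by simp
    obtain v t' t'' where v: "v \<in> Y" "t' \<in> S v" "t'' \<in> span Y" "t = t' \<otimes> t''"
      "len Y t = Suc (len Y t'')"
      using len_cases[OF assms(2) tY \<open>t \<noteq> \<one>\<close>] by metis
    \<comment> \<open>After its first letter nothing remains of \<open>t\<close>, so
      \<open>t\<close> itself lies in one \<open>S v\<close>.\<close>
    have "len Y t'' = 0" using v(5) \<open>len I t \<le> 1\<close> len_span[OF assms(2) tY] by simp
    then have "has_word Y 0 t''" using has_word_len[OF assms(2) v(3)] by simp
    then have "t'' = \<one>" by (cases rule: has_word.cases)
    have vI: "v \<in> I" using v assms by blast
    then have tv: "t \<in> S v" using v \<open>t'' = \<one>\<close> S_carrier by auto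
    \<comment> \<open>Evaluating the cocycle of \<open>r h = h t\<close> at \<open>S u\<close> shows
      that \<open>t\<close> moves along \<open>?T\<close>. A letter from \<open>S v\<close> moves
      along \<open>S v\<close> only, so the two walls coincide.\<close>
    have "N (r \<otimes> h) (S u) = r"
      using N_mult_generator[OF u r(1) h] Nh rt by simp
    then have "N t ?T \<noteq> \<one>"
      using Nhb[OF rt(2)] ht \<open>r \<noteq> \<one>\<close> h by auto
    then have "?T = S v" using N_generator[OF vI tv T] by (simp split: if_splits)
    then have "S u = conj_set h (S v)" using h Su by (metis conj_set_inv_right)
    then have "u \<in> ?Z" using d v by (auto simp: common_generators_def)
    then have rZ: "r \<in> span ?Z" using r S_span by blast
    have "(r \<otimes> a) \<otimes> h = h \<otimes> (t \<otimes> b)"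
      using less.prems(3) ht rt ab h by (metis m_assoc)
    moreover have "len I (t \<otimes> b) < len I b"
      using t len_span[OF assms(2)] less.prems by simp
    moreover have "r \<otimes> a \<in> span X" using rX less.prems spX subgroup.m_closed by metis
    ultimately have "r \<otimes> a \<in> span ?Z" using less.hyps t by blast
    moreover have "a = inv r \<otimes> (r \<otimes> a)" using rt ab by (simp flip: m_assoc)
    ultimately show ?thesis
      using rZ spZ by (metis subgroup.m_closed subgroup.m_inv_closed)
  qed
qed

lemma minimal_intersection:
  assumes "X \<subseteq> I" "Y \<subseteq> I" "left_minimal X h" "left_minimal Y (inv h)"
  shows "span X \<inter> conj_set h (span Y) = span (common_generators X Y h)"
proof
  let ?Z = "common_generators X Y h"
  have h: "h \<in> carrier P" using assms(3) by (simp add: left_minimal_def)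
  show "span X \<inter> conj_set h (span Y) \<subseteq> span ?Z"
  proof
    fix a assume "a \<in> span X \<inter> conj_set h (span Y)"
    then obtain b where ab: "a \<in> span X" "b \<in> span Y" "a = h \<otimes> b \<otimes> inv h"
      by (auto simp: conj_set_def)
    then have "a \<otimes> h = h \<otimes> b" using h span_subset[OF assms(2)] by (auto simp: m_assoc)
    then show "a \<in> span ?Z" using minimal_intersection_subset assms ab by blast
  qed
  have Z: "?Z \<subseteq> X" by (auto simp: common_generators_def)
  have "span ?Z \<subseteq> conj_set h (span Y)"
    unfolding span_def[of ?Z]
  proof (rule generate_subgroup_incl)
    have "S u \<subseteq> conj_set h (span Y)" if u: "u \<in> ?Z" for u
    proof -
      obtain v where "v \<in> Y" "S u = conj_set h (S v)"
        using u by (auto simp: common_generators_def)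
      then show ?thesis using S_span by (simp add: conj_set_def image_mono)
    qed
    then show "(\<Union>u\<in>?Z. S u) \<subseteq> conj_set h (span Y)" by blast
    show "subgroup (conj_set h (span Y)) P"
      unfolding conj_set_def[of h "span Y"]
    proof (rule group_hom.subgroup_img_is_subgroup[OF _ subgroup_span[OF assms(2)]])
      show "group_hom P P (\<lambda>t. h \<otimes> t \<otimes> inv h)"
      proof unfold_locales
        have "inv h \<otimes> (h \<otimes> z) = z" if "z \<in> carrier P" for z
          using h that by (simp flip: m_assoc)
        then show "(\<lambda>t. h \<otimes> t \<otimes> inv h) \<in> hom P P"
          using h by (intro homI) (simp_all add: m_assoc)
      qed
    qed
  qed
  then show "span ?Z \<subseteq> span X \<inter> conj_set h (span Y)" using span_mono[OF Z] by blast
qed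

text \<open>Minimising the length over all \<open>x g y\<close>, that is over the whole double
  coset, yields both one-sided minimalities at once.\<close>

lemma ex_minimal:
  assumes "X \<subseteq> I" "Y \<subseteq> I" "g \<in> carrier P"
  obtains x y where "x \<in> span X" "y \<in> span Y"
    "left_minimal X (x \<otimes> g \<otimes> y)" "left_minimal Y (inv (x \<otimes> g \<otimes> y))"
proof -
  have spX: "subgroup (span X) P" and spY: "subgroup (span Y) P"
    using subgroup_span assms by blast+
  obtain p where "p \<in> span X \<times> span Y"
    and least: "\<And>q. q \<in> span X \<times> span Y
      \<Longrightarrow> len I (fst p \<otimes> g \<otimes> snd p) \<le> len I (fst q \<otimes> g \<otimes> snd q)"
    using ex_has_least_nat[of "\<lambda>p. p \<in> span X \<times> span Y" "(\<one>, \<one>)" "\<lambda>p. len I (fst p \<otimes> g \<otimes> snd p)"]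
      spX spY subgroup.one_closed by blast
  then obtain x y where xy: "x \<in> span X" "y \<in> span Y" "p = (x, y)" by auto
  have min: "len I (x \<otimes> g \<otimes> y) \<le> len I (x' \<otimes> g \<otimes> y')" if "x' \<in> span X" "y' \<in> span Y" for x' y'
    using least[of "(x', y')"] that xy by simp
  have c: "x \<in> carrier P" "y \<in> carrier P" using xy assms span_subset by blast+
  let ?h = "x \<otimes> g \<otimes> y"
  have "len I ?h \<le> len I (a \<otimes> ?h)" if "a \<in> span X" for a
  proof -
    have "a \<in> carrier P" using that assms span_subset by blast
    then show ?thesis
      using min[of "a \<otimes> x" y] that xy c assms(3) spX subgroup.m_closed by (fastforce simp: m_assoc)
  qed
  moreover have "len I (inv ?h) \<le> len I (b \<otimes> inv ?h)" if "b \<in> span Y" for b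
  proof -
    have b: "b \<in> carrier P" using that assms span_subset by blast
    have "y \<otimes> inv b \<in> span Y" using that xy spY by (meson subgroup.m_closed subgroup.m_inv_closed)
    then have "len I ?h \<le> len I (x \<otimes> g \<otimes> (y \<otimes> inv b))" using min xy by blast
    \<comment> \<open>Multiplying the inverse by \<open>b\<close> on the left is multiplying on the
      right by \<open>inv b\<close>, which stays in the double coset.\<close>
    also have "x \<otimes> g \<otimes> (y \<otimes> inv b) = inv (b \<otimes> inv ?h)"
      using b c assms(3) by (simp add: inv_mult_group m_assoc)
    finally show ?thesis using len_inv b c assms(3) by simp
  qed
  ultimately have "left_minimal X ?h" "left_minimal Y (inv ?h)"
    using c assms(3) by (auto simp: left_minimal_def)
  then show ?thesis using that xy by blast
qed

text \<open>Let \<open>h = x (inv g k) y\<close> be minimal in its double coset and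
  \<open>c = g inv x\<close>. Then \<open>c\<close> and \<open>g\<close> conjugate
  \<open>span X\<close> alike, as \<open>x\<close> normalises it, and \<open>c h = k y\<close> and
  \<open>k\<close> conjugate \<open>span Y\<close> alike. Conjugating the minimal case by
  \<open>c\<close> gives the claim.\<close>

theorem conjugate_span_Int:
  assumes "X \<subseteq> I" "Y \<subseteq> I" "g \<in> carrier P" "k \<in> carrier P"
  shows "\<exists>Z\<subseteq>I. \<exists>c\<in>carrier P. conj_set g (span X) \<inter> conj_set k (span Y) = conj_set c (span Z)"
proof -
  have "inv g \<otimes> k \<in> carrier P" using assms by simp
  then obtain x y where xy: "x \<in> span X" "y \<in> span Y"
    and min: "left_minimal X (x \<otimes> (inv g \<otimes> k) \<otimes> y)" "left_minimal Y (inv (x \<otimes> (inv g \<otimes> k) \<otimes> y))"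
    using ex_minimal assms by metis
  have c: "x \<in> carrier P" "y \<in> carrier P" using xy assms span_subset by blast+
  let ?h = "x \<otimes> (inv g \<otimes> k) \<otimes> y" and ?c = "g \<otimes> inv x"
  have sub: "span X \<subseteq> carrier P" "span Y \<subseteq> carrier P" using span_subset assms by blast+
  have cc: "?c \<in> carrier P" "?h \<in> carrier P" using c assms by auto
  have "conj_set ?c (span X) = conj_set g (span X)"
    using conj_set_subgroup[OF subgroup_span[OF assms(1)]] xy c assms sub
      subgroup.m_inv_closed[OF subgroup_span[OF assms(1)]]
    by (simp add: conj_set_mult)
  moreover have "conj_set ?c (conj_set ?h (span Y)) = conj_set k (span Y)"
  proof -
    have "?c \<otimes> ?h = k \<otimes> y"
      using c assms by (simp add: m_assoc) (simp flip: m_assoc)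
    then have "conj_set ?c (conj_set ?h (span Y)) = conj_set (k \<otimes> y) (span Y)"
      using conj_set_mult[OF cc sub(2)] by simp
    then show ?thesis
      using conj_set_subgroup[OF subgroup_span[OF assms(2)] xy(2)] conj_set_mult[OF assms(4) c(2) sub(2)]
      by simp
  qed
  ultimately have "conj_set g (span X) \<inter> conj_set k (span Y) =
      conj_set ?c (span X \<inter> conj_set ?h (span Y))"
    using conj_set_Int[OF cc(1) sub(1) conj_set_closed[OF cc(2) sub(2)]] by simp
  also have "\<dots> = conj_set ?c (span (common_generators X Y ?h))"
    using minimal_intersection[OF assms(1,2) min] by simp
  finally show ?thesis
    using cc assms(1) by (intro exI[of _ "common_generators X Y ?h"]) (auto simp: common_generators_def)
qed

end


section \<open>The cocycle on words\<close>

text \<open>An arbitrary group in which the defining relations hold. This keeps the calculations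
  with walls free of cosets of the kernel; completeness of the relations enters only in
  \<open>wall_cocycle_displ\<close>.\<close>

locale periagroup_rep = periagroup_data V E lab G + group P
  for V :: "'v set" and E :: "'v set set" and lab :: "'v set \<Rightarrow> nat"
    and G :: "'v \<Rightarrow> ('a, 'b) monoid_scheme" and P :: "('p, 'q) monoid_scheme" (structure) +
  fixes e :: "'v \<Rightarrow> 'a \<Rightarrow> 'p"
  assumes e_hom: "u \<in> V \<Longrightarrow> e u \<in> hom (G u) P"
    and braid: "\<lbrakk>{u, v} \<in> E; a \<in> carrier (G u) - {\<one>\<^bsub>G u\<^esub>}; b \<in> carrier (G v) - {\<one>\<^bsub>G v\<^esub>}\<rbrakk>
      \<Longrightarrow> foldr (\<lambda>(u, a) x. e u a \<otimes> x) (alternating (lab {u, v}) (u, a) (v, b)) \<one> =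
          foldr (\<lambda>(u, a) x. e u a \<otimes> x) (alternating (lab {u, v}) (v, b) (u, a)) \<one>"
begin

section \<open>Value and displacement of a word\<close>

definition word_val :: "('v \<times> 'a) list \<Rightarrow> 'p" where
  "word_val w = foldr (\<lambda>(u, a) x. e u a \<otimes> x) w \<one>"

definition S :: "'v \<Rightarrow> 'p set" where
  "S u = e u ` carrier (G u)"

text \<open>After the first letter the path continues from \<open>s\<close>, so it meets the walls
  translated by \<open>s\<close>. The factor of the first letter stands on the right: within one
  vertex-group it cancels \<open>inv s\<close>, and the letters contribute their product in reading
  order.\<close>

primrec displ :: "('v \<times> 'a) list \<Rightarrow> 'p set \<Rightarrow> 'p" where
  "displ [] T = \<one>"
| "displ (l # w) T = (let s = e (fst l) (snd l) in
     s \<otimes> displ w (conj_set (inv s) T) \<otimes> inv s \<otimes> (if T = S (fst l) then s else \<one>))"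

lemma word_val_Nil [simp]: "word_val [] = \<one>"
  and word_val_Cons [simp]: "word_val ((u, a) # w) = e u a \<otimes> word_val w"
  by (simp_all add: word_val_def)

lemma e_closed: "u \<in> V \<Longrightarrow> a \<in> carrier (G u) \<Longrightarrow> e u a \<in> carrier P"
  by (rule hom_in_carrier[OF e_hom])

lemma e_mult:
  "\<lbrakk>u \<in> V; a \<in> carrier (G u); b \<in> carrier (G u)\<rbrakk> \<Longrightarrow> e u (a \<otimes>\<^bsub>G u\<^esub> b) = e u a \<otimes> e u b"
  by (rule hom_mult[OF e_hom])

lemma e_one: "u \<in> V \<Longrightarrow> e u \<one>\<^bsub>G u\<^esub> = \<one>"
  by (rule hom_one[OF e_hom vertex_group is_group])

lemma subgroup_S: "u \<in> V \<Longrightarrow> subgroup (S u) P"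
  unfolding S_def using e_hom vertex_group is_group
  by (intro group_hom.img_is_subgroup) (simp add: group_hom_def group_hom_axioms_def)

lemma S_subset: "u \<in> V \<Longrightarrow> S u \<subseteq> carrier P"
  by (rule subgroup.subset[OF subgroup_S])

lemma words_Cons: "(u, a) # w \<in> fp_words V G \<longleftrightarrow> u \<in> V \<and> a \<in> carrier (G u) \<and> w \<in> fp_words V G"
  by (auto simp: fp_words_def)

lemma words_Nil: "[] \<in> fp_words V G"
  by (simp add: fp_words_def)

lemma word_val_closed: "w \<in> fp_words V G \<Longrightarrow> word_val w \<in> carrier P"
  by (induction w) (auto simp: words_Cons e_closed)

lemma word_val_append:
  "\<lbrakk>x \<in> fp_words V G; y \<in> fp_words V G\<rbrakk> \<Longrightarrow> word_val (x @ y) = word_val x \<otimes> word_val y"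
  by (induction x) (auto simp: words_Cons e_closed word_val_closed m_assoc)

lemma displ_closed:
  "\<lbrakk>w \<in> fp_words V G; T \<subseteq> carrier P\<rbrakk> \<Longrightarrow> displ w T \<in> carrier P"
  by (induction w arbitrary: T) (auto simp: words_Cons e_closed Let_def conj_set_closed)

text \<open>This is the rule \<open>N_mult\<close> before passing from words to group
  elements.\<close>

lemma displ_append:
  assumes "x \<in> fp_words V G" "y \<in> fp_words V G" "T \<subseteq> carrier P"
  shows "displ (x @ y) T =
    word_val x \<otimes> displ y (conj_set (inv (word_val x)) T) \<otimes> inv (word_val x) \<otimes> displ x T"
  using assms(1,3)
proof (induction x arbitrary: T)
  case Nil
  then show ?case using displ_closed[OF assms(2)] by simp
next
  case (Cons l x)
  obtain u a where l: "l = (u, a)" by force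
  let ?s = "e u a" and ?x = "word_val x"
  have c: "?s \<in> carrier P" "?x \<in> carrier P" and x: "x \<in> fp_words V G"
    using Cons.prems l by (auto simp: words_Cons e_closed word_val_closed)
  let ?T = "conj_set (inv ?s) T" and ?c = "if T = S u then ?s else \<one>"
  have T: "?T \<subseteq> carrier P" using conj_set_closed c Cons.prems by blast
  have eq: "conj_set (inv (?s \<otimes> ?x)) T = conj_set (inv ?x) ?T"
    using c Cons.prems by (simp add: inv_mult_group conj_set_mult)
  let ?d = "displ y (conj_set (inv ?x) ?T)" and ?d' = "displ x ?T"
  have d: "?d \<in> carrier P" "?d' \<in> carrier P" "?c \<in> carrier P"
    using displ_closed assms(2) x T conj_set_closed c by auto
  have "?s \<otimes> (?x \<otimes> ?d \<otimes> inv ?x \<otimes> ?d') \<otimes> inv ?s \<otimes> ?c =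
      ?s \<otimes> ?x \<otimes> ?d \<otimes> inv (?s \<otimes> ?x) \<otimes> (?s \<otimes> ?d' \<otimes> inv ?s \<otimes> ?c)"
  proof -
    have "inv ?s \<otimes> (?s \<otimes> z) = z" if "z \<in> carrier P" for z
      using c that by (simp flip: m_assoc)
    then show ?thesis using c d by (simp add: m_assoc inv_mult_group)
  qed
  then show ?case using Cons.IH[OF x T] eq by (simp add: l Let_def)
qed

lemma displ_letter:
  "\<lbrakk>u \<in> V; a \<in> carrier (G u)\<rbrakk> \<Longrightarrow> displ [(u, a)] T = (if T = S u then e u a else \<one>)"
  by (simp add: Let_def e_closed)

section \<open>Invariance of the displacement under the defining relations\<close>

lemma conj_set_eq_iff:
  assumes "x \<in> carrier P" "T \<subseteq> carrier P" "U \<subseteq> carrier P"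
  shows "conj_set (inv x) T = U \<longleftrightarrow> T = conj_set x U"
  using assms by auto

lemma displ_mult:
  assumes "u \<in> V" "a \<in> carrier (G u)" "b \<in> carrier (G u)" "T \<subseteq> carrier P"
  shows "displ [(u, a), (u, b)] T = displ [(u, a \<otimes>\<^bsub>G u\<^esub> b)] T"
proof -
  have c: "e u a \<in> carrier P" "e u b \<in> carrier P" using assms e_closed by auto
  have "e u a \<in> S u" using assms by (simp add: S_def)
  then have "conj_set (inv (e u a)) T = S u \<longleftrightarrow> T = S u"
    using conj_set_eq_iff[OF c(1) assms(4) S_subset[OF assms(1)]]
      conj_set_subgroup[OF subgroup_S[OF assms(1)]] by simp
  then show ?thesis
    using assms c by (auto simp: Let_def e_mult m_assoc)
qed

lemma displ_one: "u \<in> V \<Longrightarrow> displ [(u, \<one>\<^bsub>G u\<^esub>)] T = \<one>"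
  using displ_letter[of u "\<one>\<^bsub>G u\<^esub>"] by (simp add: e_one vertex_group group.is_monoid)

text \<open>The two subgroups commute elementwise, so each letter fixes the wall and the
  contribution of the other. Should the walls \<open>S u\<close> and \<open>S v\<close> coincide,
  the two factors meet there and still commute.\<close>

lemma displ_commute:
  assumes "{u, v} \<in> E" "lab {u, v} = 2"
    "a \<in> carrier (G u) - {\<one>\<^bsub>G u\<^esub>}" "b \<in> carrier (G v) - {\<one>\<^bsub>G v\<^esub>}" "T \<subseteq> carrier P"
  shows "displ [(u, a), (v, b)] T = displ [(v, b), (u, a)] T"
proof -
  have uv: "u \<in> V" "v \<in> V" using assms edge_subset by auto
  let ?s = "e u a" and ?t = "e v b"
  have c: "?s \<in> carrier P" "?t \<in> carrier P" using assms uv e_closed by auto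
  \<comment> \<open>Fixing a wall as a set calls for all pairs of elements, not only
    \<open>a\<close> and \<open>b\<close>; \<open>braid\<close> covers every nontrivial
    pair.\<close>
  have comm: "e u x \<otimes> e v y = e v y \<otimes> e u x" if "x \<in> carrier (G u)" "y \<in> carrier (G v)" for x y
  proof (cases "x = \<one>\<^bsub>G u\<^esub> \<or> y = \<one>\<^bsub>G v\<^esub>")
    case True
    then show ?thesis using that uv e_one e_closed by auto
  next
    case False
    then show ?thesis
      using braid[of u v x y] that assms uv e_closed by (simp add: numeral_2_eq_2)
  qed
  have conj: "conj_set x U = U"
    if "x \<in> carrier P" "U \<subseteq> carrier P" "\<And>y. y \<in> U \<Longrightarrow> x \<otimes> y = y \<otimes> x" for x U
  proof -
    have "x \<otimes> y \<otimes> inv x = y" if "y \<in> U" for y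
    proof -
      have "y \<in> carrier P" using \<open>U \<subseteq> carrier P\<close> that by blast
      then show ?thesis
        using \<open>x \<in> carrier P\<close> \<open>\<And>y. y \<in> U \<Longrightarrow> x \<otimes> y = y \<otimes> x\<close>[OF that] by (simp add: m_assoc)
    qed
    then show ?thesis by (simp add: conj_set_def)
  qed
  have "conj_set ?s (S v) = S v"
    using comm assms by (intro conj c S_subset uv) (auto simp: S_def)
  then have 1: "conj_set (inv ?s) T = S v \<longleftrightarrow> T = S v"
    using conj_set_eq_iff[OF c(1) assms(5) S_subset[OF uv(2)]] by simp
  have "conj_set ?t (S u) = S u"
    using comm[symmetric] assms by (intro conj c S_subset uv) (auto simp: S_def)
  then have 2: "conj_set (inv ?t) T = S u \<longleftrightarrow> T = S u"
    using conj_set_eq_iff[OF c(2) assms(5) S_subset[OF uv(1)]] by simp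
  have st: "?s \<otimes> ?t = ?t \<otimes> ?s" using comm assms by simp
  have conj': "?s \<otimes> ?t \<otimes> inv ?s = ?t"
    using c by (simp add: st m_assoc)
  have conj'': "?t \<otimes> ?s \<otimes> inv ?t = ?s"
    using c by (simp add: st[symmetric] m_assoc)
  show ?thesis using c st 1 2 conj' conj'' by (auto simp: Let_def)
qed

lemma conj_nat_pow:
  assumes "x \<in> carrier P" "r \<in> carrier P"
  shows "x \<otimes> (inv x \<otimes> r \<otimes> x) [^] (n::nat) \<otimes> inv x = r [^] n"
proof (induction n)
  case (Suc n)
  have "x \<otimes> (inv x \<otimes> r \<otimes> x) [^] Suc n \<otimes> inv x =
      (x \<otimes> (inv x \<otimes> r \<otimes> x) [^] n \<otimes> inv x) \<otimes> r"
    using assms by (simp add: m_assoc)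
  then show ?case using Suc by simp
qed (use assms in simp)

text \<open>
  In a dihedral group the walls crossed by \<open>stst\<dots>\<close> are \<open>{\<one>, (s t)\<^sup>j s}\<close>, and each
  crossing of \<open>{\<one>, r}\<close> contributes a factor \<open>r\<close>. For other \<open>T\<close> both sides are trivial and
  any \<open>r\<close> will do.
\<close>

lemma displ_alternating:
  assumes "u \<in> V" "v \<in> V" "a \<in> carrier (G u)" "b \<in> carrier (G v)"
    and "S u = {\<one>, e u a}" "S v = {\<one>, e v b}" "e u a \<otimes> e u a = \<one>" "e v b \<otimes> e v b = \<one>"
    and "T \<subseteq> carrier P" "r \<in> carrier P" "\<And>x. x \<in> carrier P \<Longrightarrow> T = {\<one>, x} \<Longrightarrow> x = r"
  shows "displ (alternating k (u, a) (v, b)) T =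
    r [^] (\<Sum>j<k. of_bool (T = {\<one>, (e u a \<otimes> e v b) [^] j \<otimes> e u a}) :: nat)"
  using assms
proof (induction k arbitrary: u v a b T r)
  case (Suc k)
  let ?s = "e u a" and ?t = "e v b"
  have c: "?s \<in> carrier P" "?t \<in> carrier P" using Suc.prems e_closed by auto
  have inv: "inv ?s = ?s" using c Suc.prems inv_equality by metis
  \<comment> \<open>The remaining word sees the wall pulled back by \<open>s\<close>, and
    \<open>r\<close> is pulled back with it.\<close>
  let ?T = "conj_set (inv ?s) T" and ?r = "inv ?s \<otimes> r \<otimes> ?s"
  have T: "?T \<subseteq> carrier P" using conj_set_closed c Suc.prems by blast
  have conj: "conj_set ?s {\<one>, x} = {\<one>, ?s \<otimes> x \<otimes> inv ?s}" for x
    using c by (simp add: conj_set_def)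
  have shift: "?T = {\<one>, x} \<longleftrightarrow> T = {\<one>, ?s \<otimes> x \<otimes> inv ?s}" if "x \<in> carrier P" for x
    using conj_set_eq_iff[OF c(1) Suc.prems(9), of "{\<one>, x}"] that by (simp add: conj)
  have "x = ?r" if x: "x \<in> carrier P" "?T = {\<one>, x}" for x
  proof -
    have "?s \<otimes> x \<otimes> inv ?s = r" using Suc.prems(11) shift[OF x(1)] x c by simp
    then have "r \<otimes> ?s = ?s \<otimes> x" using x c by (auto simp: m_assoc)
    then show ?thesis using x c Suc.prems(10) by (simp add: m_assoc) (simp flip: m_assoc)
  qed
  then have "displ (alternating k (v, b) (u, a)) ?T =
      ?r [^] (\<Sum>j<k. of_bool (?T = {\<one>, (?t \<otimes> ?s) [^] j \<otimes> ?t}) :: nat)"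
    using Suc.prems T c by (intro Suc.IH) auto
  \<comment> \<open>Conjugation by \<open>s\<close> takes reflection number \<open>j\<close> of the
    remaining word to number \<open>j + 1\<close> of the full word.\<close>
  also have "(\<Sum>j<k. of_bool (?T = {\<one>, (?t \<otimes> ?s) [^] j \<otimes> ?t}) :: nat) =
      (\<Sum>j<k. of_bool (T = {\<one>, (?s \<otimes> ?t) [^] Suc j \<otimes> ?s}))"
  proof (rule sum.cong[OF HOL.refl])
    fix j :: nat
    have "?s \<otimes> ((?t \<otimes> ?s) [^] j \<otimes> ?t) = (?s \<otimes> ?t) [^] j \<otimes> (?s \<otimes> ?t)"
    proof (induction j)
      case (Suc j)
      have "?s \<otimes> ((?t \<otimes> ?s) [^] Suc j \<otimes> ?t) = ?s \<otimes> ((?t \<otimes> ?s) [^] j \<otimes> ?t) \<otimes> (?s \<otimes> ?t)"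
        using c by (simp add: m_assoc)
      then show ?case using Suc c by simp
    qed (use c in simp)
    then have "?s \<otimes> ((?t \<otimes> ?s) [^] j \<otimes> ?t) \<otimes> inv ?s = (?s \<otimes> ?t) [^] Suc j \<otimes> ?s"
      by (simp add: inv)
    then show "(of_bool (?T = {\<one>, (?t \<otimes> ?s) [^] j \<otimes> ?t}) :: nat) =
        of_bool (T = {\<one>, (?s \<otimes> ?t) [^] Suc j \<otimes> ?s})"
      using shift[of "(?t \<otimes> ?s) [^] j \<otimes> ?t"] c by simp
  qed
  finally have IH: "displ (alternating k (v, b) (u, a)) ?T =
      ?r [^] (\<Sum>j<k. of_bool (T = {\<one>, (?s \<otimes> ?t) [^] Suc j \<otimes> ?s}) :: nat)" .
  let ?n = "\<Sum>j<k. of_bool (T = {\<one>, (?s \<otimes> ?t) [^] Suc j \<otimes> ?s}) :: nat"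
  \<comment> \<open>The first letter supplies the summand for \<open>j = 0\<close>.\<close>
  have "(if T = S u then ?s else \<one>) = r [^] (of_bool (T = {\<one>, ?s}) :: nat)"
    using Suc.prems(5,10) Suc.prems(11)[OF c(1)] by (cases "T = {\<one>, ?s}") simp_all
  then have "displ (alternating (Suc k) (u, a) (v, b)) T =
      r [^] ?n \<otimes> r [^] (of_bool (T = {\<one>, ?s}) :: nat)"
    using IH conj_nat_pow[OF c(1) Suc.prems(10)] by (simp add: Let_def)
  also have "\<dots> = r [^] (?n + of_bool (T = {\<one>, ?s}))"
    using Suc.prems(10) by (simp add: nat_pow_mult)
  also have "?n + of_bool (T = {\<one>, ?s}) =
      (\<Sum>j<Suc k. of_bool (T = {\<one>, (?s \<otimes> ?t) [^] j \<otimes> ?s}))"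
    using c by (subst sum.lessThan_Suc_shift) simp
  finally show ?case .
qed simp

text \<open>Turns the braid relation into the Coxeter relation: if \<open>k\<close> is the label,
  both alternating words have the same value, and cancelling it leaves
  \<open>(s t)^k = \<one>\<close>.\<close>

lemma pow_alternating:
  assumes "{u, v} \<in> E" "a \<in> carrier (G u)" "b \<in> carrier (G v)"
    and "e u a \<otimes> e u a = \<one>" "e v b \<otimes> e v b = \<one>"
  shows "word_val (alternating k (u, a) (v, b)) =
    (e u a \<otimes> e v b) [^] k \<otimes> word_val (alternating k (v, b) (u, a))"
  using assms
proof (induction k arbitrary: u v a b)
  case (Suc k)
  let ?s = "e u a" and ?t = "e v b" and ?x = "word_val (alternating k (u, a) (v, b))"
  have uv: "u \<in> V" "v \<in> V" using Suc.prems edge_subset by auto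
  have c: "?s \<in> carrier P" "?t \<in> carrier P" using Suc.prems uv e_closed by auto
  have x: "?x \<in> carrier P" using word_val_closed alternating_words Suc.prems by blast
  have "?s \<otimes> ((?t \<otimes> ?s) [^] k \<otimes> ?x) = (?s \<otimes> ?t) [^] Suc k \<otimes> (?t \<otimes> ?x)"
  proof -
    have "?s \<otimes> (?t \<otimes> ?s) [^] k = (?s \<otimes> ?t) [^] k \<otimes> ?s"
    proof (induction k)
      case (Suc k)
      have "?s \<otimes> (?t \<otimes> ?s) [^] Suc k = ?s \<otimes> (?t \<otimes> ?s) [^] k \<otimes> (?t \<otimes> ?s)"
        using c by (simp add: m_assoc)
      then show ?case using Suc c by (simp add: m_assoc)
    qed (use c in simp)
    moreover have "?t \<otimes> (?t \<otimes> ?x) = ?x" using c x Suc.prems by (simp flip: m_assoc)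
    ultimately show ?thesis using c x by (simp add: m_assoc) (simp flip: m_assoc)
  qed
  then show ?case
    using Suc.IH[of v u b a] Suc.prems by (simp add: insert_commute)
qed simp

text \<open>By \<open>displ_alternating\<close> each side is a power of one element
  \<open>r\<close>, the exponent counting how often \<open>T\<close> is crossed. The two sides run
  through the same reflections in opposite order, so the counts agree.\<close>

lemma displ_braid_dihedral:
  assumes "{u, v} \<in> E" "lab {u, v} > 2"
    "a \<in> carrier (G u) - {\<one>\<^bsub>G u\<^esub>}" "b \<in> carrier (G v) - {\<one>\<^bsub>G v\<^esub>}" "T \<subseteq> carrier P"
  shows "displ (alternating (lab {u, v}) (u, a) (v, b)) T =
    displ (alternating (lab {u, v}) (v, b) (u, a)) T"
proof -
  have uv: "u \<in> V" "v \<in> V" using assms edge_subset by auto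
  let ?s = "e u a" and ?t = "e v b" and ?m = "lab {u, v}"
  have c: "?s \<in> carrier P" "?t \<in> carrier P" using assms uv e_closed by auto
  have two: "S w = {\<one>, e w x} \<and> e w x \<otimes> e w x = \<one>"
    if w: "w \<in> {u, v}" "x \<in> carrier (G w) - {\<one>\<^bsub>G w\<^esub>}" for w x
  proof -
    have wV: "w \<in> V" using w uv by auto
    interpret Gw: group "G w" using vertex_group wV .
    have "card (carrier (G w)) = 2" using order_two[OF assms(1,2) w(1)] by (simp add: order_def)
    then have eq: "{\<one>\<^bsub>G w\<^esub>, x} = carrier (G w)"
      using w(2) by (intro card_subset_eq card_ge_0_finite) auto
    have "x \<otimes>\<^bsub>G w\<^esub> x \<noteq> x" using w(2) by simp
    then have "x \<otimes>\<^bsub>G w\<^esub> x = \<one>\<^bsub>G w\<^esub>" using eq w(2) Gw.m_closed[of x x] by blast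
    then show ?thesis using eq[symmetric] e_mult[OF wV, of x x] e_one[OF wV] w(2) by (auto simp: S_def)
  qed
  have S: "S u = {\<one>, ?s}" "?s \<otimes> ?s = \<one>" "S v = {\<one>, ?t}" "?t \<otimes> ?t = \<one>"
    using two[of u a] two[of v b] assms by auto
  have "(?s \<otimes> ?t) [^] ?m \<otimes> word_val (alternating ?m (v, b) (u, a)) =
      word_val (alternating ?m (v, b) (u, a))"
    using pow_alternating[OF assms(1), of a b ?m] braid[OF assms(1,3,4)] assms S
    by (simp add: word_val_def)
  moreover have "word_val (alternating ?m (v, b) (u, a)) \<in> carrier P"
    using word_val_closed alternating_words[of v u b a] assms by (simp add: insert_commute)
  ultimately have pow: "(?s \<otimes> ?t) [^] ?m = \<one>" using c by simp
  have inv_st: "inv (?s \<otimes> ?t) = ?t \<otimes> ?s"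
    using c S inv_equality by (metis inv_mult_group)
  \<comment> \<open>With \<open>m\<close> the label, \<open>(t s)^j t = (t s)^(j+1) s\<close>, and
    \<open>(t s)^(j+1)\<close> is the inverse of \<open>(s t)^(j+1)\<close>, hence
    \<open>(s t)^(m-j-1)\<close>.\<close>
  have refl: "(?t \<otimes> ?s) [^] j \<otimes> ?t = (?s \<otimes> ?t) [^] (?m - Suc j) \<otimes> ?s" if "j < ?m" for j :: nat
  proof -
    have "(?s \<otimes> ?t) [^] (?m - Suc j) \<otimes> (?s \<otimes> ?t) [^] Suc j = \<one>"
      using c that pow by (simp only: nat_pow_mult m_closed) simp
    then have "(?s \<otimes> ?t) [^] (?m - Suc j) = inv ((?s \<otimes> ?t) [^] Suc j)"
      using c by (metis inv_equality inv_inv m_closed nat_pow_closed inv_closed)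
    also have "\<dots> = (?t \<otimes> ?s) [^] Suc j"
      using c inv_st by (metis nat_pow_inv m_closed)
    finally show ?thesis using c S by (simp add: m_assoc)
  qed
  \<comment> \<open>At most one \<open>x\<close> satisfies \<open>T = {\<one>, x}\<close>. If there
    is none, the condition is vacuous and \<open>\<one>\<close> is chosen.\<close>
  obtain r where r: "r \<in> carrier P" "\<And>x. x \<in> carrier P \<Longrightarrow> T = {\<one>, x} \<Longrightarrow> x = r"
  proof (cases "\<exists>r\<in>carrier P. T = {\<one>, r}")
    case True
    then obtain r where "r \<in> carrier P" "T = {\<one>, r}" by blast
    then show ?thesis by (intro that[of r]) (auto simp: doubleton_eq_iff)
  next
    case False
    then show ?thesis by (intro that[of \<one>]) auto
  qed
  have "displ (alternating ?m (v, b) (u, a)) T =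
      r [^] (\<Sum>j<?m. of_bool (T = {\<one>, (?t \<otimes> ?s) [^] j \<otimes> ?t}) :: nat)"
    using assms uv S r by (intro displ_alternating) auto
  also have "(\<Sum>j<?m. of_bool (T = {\<one>, (?t \<otimes> ?s) [^] j \<otimes> ?t}) :: nat) =
      (\<Sum>j<?m. of_bool (T = {\<one>, (?s \<otimes> ?t) [^] (?m - Suc j) \<otimes> ?s}))"
    by (rule sum.cong) (simp_all add: refl)
  also have "\<dots> = (\<Sum>j<?m. of_bool (T = {\<one>, (?s \<otimes> ?t) [^] j \<otimes> ?s}))"
    by (rule sum.nat_diff_reindex)
  also have "r [^] \<dots> = displ (alternating ?m (u, a) (v, b)) T"
    using assms uv S r by (intro displ_alternating[symmetric]) auto
  finally show ?thesis by simp
qed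

lemma displ_braid:
  assumes "{u, v} \<in> E"
    "a \<in> carrier (G u) - {\<one>\<^bsub>G u\<^esub>}" "b \<in> carrier (G v) - {\<one>\<^bsub>G v\<^esub>}" "T \<subseteq> carrier P"
  shows "displ (alternating (lab {u, v}) (u, a) (v, b)) T =
    displ (alternating (lab {u, v}) (v, b) (u, a)) T"
proof (cases "lab {u, v} = 2")
  case True
  then show ?thesis using displ_commute[OF assms(1) True assms(2-4)] by (simp add: numeral_2_eq_2)
next
  case False
  then have "lab {u, v} > 2" using lab_ge_2[OF assms(1)] by simp
  then show ?thesis using displ_braid_dihedral assms by blast
qed

section \<open>Words with the same value and displacement\<close>

definition word_cong :: "('v \<times> 'a) list \<Rightarrow> ('v \<times> 'a) list \<Rightarrow> bool" where
  "word_cong w w' \<longleftrightarrow> w \<in> fp_words V G \<and> w' \<in> fp_words V G \<and> word_val w = word_val w' \<and>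
     (\<forall>T\<subseteq>carrier P. displ w T = displ w' T)"

lemma word_cong_refl: "w \<in> fp_words V G \<Longrightarrow> word_cong w w"
  by (simp add: word_cong_def)

lemma word_cong_sym: "word_cong w w' \<Longrightarrow> word_cong w' w"
  by (simp add: word_cong_def)

lemma word_cong_trans: "word_cong w w' \<Longrightarrow> word_cong w' w'' \<Longrightarrow> word_cong w w''"
  by (simp add: word_cong_def)

text \<open>The displacement of a concatenation involves the value of its first part and conjugates
  of \<open>T\<close>; this is why the congruence records values too and ranges over all
  \<open>T\<close>.\<close>

lemma word_cong_append:
  assumes "word_cong x x'" "word_cong y y'"
  shows "word_cong (x @ y) (x' @ y')"
  using assms conj_set_closed
  by (auto simp: word_cong_def word_val_append displ_append word_val_closed)

lemma word_cong_mult: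
  "\<lbrakk>u \<in> V; a \<in> carrier (G u); b \<in> carrier (G u)\<rbrakk>
    \<Longrightarrow> word_cong [(u, a), (u, b)] [(u, a \<otimes>\<^bsub>G u\<^esub> b)]"
  using displ_mult[of u a b] vertex_group[of u]
  by (auto simp: word_cong_def words_Cons words_Nil e_mult e_closed group.is_monoid monoid.m_closed
      simp del: displ.simps)

lemma word_cong_one: "u \<in> V \<Longrightarrow> word_cong [(u, \<one>\<^bsub>G u\<^esub>)] []"
  using displ_one[of u] vertex_group[of u]
  by (auto simp: word_cong_def words_Cons words_Nil e_one group.is_monoid simp del: displ.simps(2))

lemma word_cong_braid:
  assumes "{u, v} \<in> E" "a \<in> carrier (G u) - {\<one>\<^bsub>G u\<^esub>}" "b \<in> carrier (G v) - {\<one>\<^bsub>G v\<^esub>}"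
  shows "word_cong (alternating (lab {u, v}) (u, a) (v, b)) (alternating (lab {u, v}) (v, b) (u, a))"
  using braid[OF assms] displ_braid[OF assms] assms alternating_words[of u v a b]
    alternating_words[of v u b a]
  by (auto simp: word_cong_def word_val_def insert_commute)

lemma word_val_generate: "w \<in> fp_words V G \<Longrightarrow> word_val w \<in> generate P (\<Union>u\<in>V. S u)"
proof (induction w)
  case (Cons l w)
  obtain u a where l: "l = (u, a)" by force
  then have "e u a \<in> (\<Union>u\<in>V. S u)" "w \<in> fp_words V G"
    using Cons.prems by (auto simp: words_Cons S_def)
  then show ?case using Cons.IH l by (simp add: generate.eng generate.incl)
qed (simp add: generate.one)

text \<open>Words of equal value have equal displacement, so the word picked by \<open>SOME\<close>
  does not matter, and the rules for words become the axioms of the cocycle.\<close>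

lemma wall_cocycle_displ:
  assumes surj: "carrier P = word_val ` fp_words V G"
    and presentation: "\<And>w w'. \<lbrakk>w \<in> fp_words V G; w' \<in> fp_words V G; word_val w = word_val w'\<rbrakk>
      \<Longrightarrow> word_cong w w'"
  shows "wall_cocycle P V S (\<lambda>g. displ (SOME w. w \<in> fp_words V G \<and> word_val w = g))"
proof -
  define N where "N = (\<lambda>g. displ (SOME w. w \<in> fp_words V G \<and> word_val w = g))"
  have N_eq: "N (word_val w) T = displ w T" if w: "w \<in> fp_words V G" "T \<subseteq> carrier P" for w T
  proof -
    let ?w = "SOME w'. w' \<in> fp_words V G \<and> word_val w' = word_val w"
    have "?w \<in> fp_words V G \<and> word_val ?w = word_val w"
      by (rule someI[of _ w]) (use w in simp)
    then show ?thesis using presentation[of ?w w] w by (simp add: N_def word_cong_def)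
  qed
  have "wall_cocycle P V S N"
  proof (intro wall_cocycle.intro wall_cocycle_axioms.intro is_group)
    show "generate P (\<Union>u\<in>V. S u) = carrier P"
    proof
      show "generate P (\<Union>u\<in>V. S u) \<subseteq> carrier P"
        using S_subset by (intro generate_incl UN_least)
      show "carrier P \<subseteq> generate P (\<Union>u\<in>V. S u)"
        unfolding surj using word_val_generate by (rule image_subsetI)
    qed
    show "subgroup (S u) P" if "u \<in> V" for u
      using that by (rule subgroup_S)
    show "N g T \<in> carrier P" if "g \<in> carrier P" "T \<subseteq> carrier P" for g T
      using that surj N_eq displ_closed by auto
    show "N (x \<otimes> y) T = x \<otimes> N y (conj_set (inv x) T) \<otimes> inv x \<otimes> N x T"
      if xy: "x \<in> carrier P" "y \<in> carrier P" "T \<subseteq> carrier P" for x y T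
    proof -
      obtain w w' where w: "w \<in> fp_words V G" "w' \<in> fp_words V G" "x = word_val w" "y = word_val w'"
        using xy surj by blast
      have "N (x \<otimes> y) T = displ (w @ w') T"
        using N_eq[of "w @ w'" T] w xy by (simp add: word_val_append)
      then show ?thesis
        using w xy by (simp add: displ_append N_eq conj_set_closed)
    qed
    show "N s T = (if T = S u then s else \<one>)" if s: "u \<in> V" "s \<in> S u" "T \<subseteq> carrier P" for u s T
    proof -
      obtain a where a: "a \<in> carrier (G u)" "s = e u a" using s by (auto simp: S_def)
      then show ?thesis
        using N_eq[of "[(u, a)]" T] displ_letter[of u a T] s
        by (simp add: words_Cons words_Nil e_closed del: displ.simps)
    qed
  qed
  then show ?thesis by (simp add: N_def)
qed

end


section \<open>The presentation of a periagroup\<close>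

context periagroup_data
begin

abbreviation "FP \<equiv> free_product V G"
abbreviation "PG \<equiv> periagroup V E lab G"
abbreviation "K \<equiv> periagroup_kernel V E lab G"

section \<open>Words as elements of the periagroup\<close>

definition elt :: "('v \<times> 'a) list \<Rightarrow> ('v \<times> 'a) list set set" where
  "elt w = K #>\<^bsub>FP\<^esub> fp_class V G w"

lemma groups: "\<forall>u\<in>V. group (G u)"
  by (simp add: vertex_group)

lemma group_FP: "group FP"
  by (rule group_free_product[OF groups])

lemma fp_class_closed: "w \<in> fp_words V G \<Longrightarrow> fp_class V G w \<in> carrier FP"
  by (simp add: fp_carrier[OF groups])

lemma Nil_words: "[] \<in> fp_words V G"
  by (simp add: fp_words_def)

lemma fp_class_Nil: "fp_class V G [] = \<one>\<^bsub>FP\<^esub>"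
  by (simp add: free_product_def)

lemma fp_class_inv:
  assumes "w \<in> fp_words V G"
  obtains w' where "w' \<in> fp_words V G" "inv\<^bsub>FP\<^esub> (fp_class V G w) = fp_class V G w'"
    "fp_eq V G (w @ w') []" "fp_eq V G (w' @ w) []"
proof -
  interpret F: group FP by (rule group_FP)
  have "inv\<^bsub>FP\<^esub> (fp_class V G w) \<in> carrier FP" using fp_class_closed assms by simp
  then obtain w' where w': "w' \<in> fp_words V G" "inv\<^bsub>FP\<^esub> (fp_class V G w) = fp_class V G w'"
    by (auto simp: fp_carrier[OF groups])
  have "fp_class V G (w @ w') = fp_class V G []" "fp_class V G (w' @ w) = fp_class V G []"
    using w' assms fp_class_closed F.r_inv F.l_inv
    by (simp_all add: fp_class_Nil flip: fp_mult[OF groups] w'(2))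
  then have "fp_eq V G (w @ w') []" "fp_eq V G (w' @ w) []"
    using fp_class_eq_iff[OF groups] w' assms Nil_words by auto
  then show ?thesis using that w' by blast
qed

lemma kernel_subgroup: "subgroup K FP"
  using normal_kernel by (rule normal_imp_subgroup)

lemma carrier_PG: "carrier PG = elt ` fp_words V G"
  by (auto simp: elt_def periagroup_def FactGroup_def RCOSETS_def fp_carrier[OF groups])

lemma elt_append:
  "\<lbrakk>x \<in> fp_words V G; y \<in> fp_words V G\<rbrakk> \<Longrightarrow> elt (x @ y) = elt x \<otimes>\<^bsub>PG\<^esub> elt y"
  by (simp add: elt_def periagroup_def FactGroup_def normal.rcos_sum[OF normal_kernel]
      fp_class_closed fp_mult[OF groups])

lemma elt_Nil: "elt [] = \<one>\<^bsub>PG\<^esub>"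
  using group.coset_mult_one[OF group_FP] subgroup.subset[OF kernel_subgroup]
  by (simp add: elt_def fp_class_Nil periagroup_def FactGroup_def)

lemma elt_cong:
  assumes "fp_eq V G w w'"
  shows "elt w = elt w'"
proof -
  have "w \<in> fp_words V G" "w' \<in> fp_words V G"
    using fp_eq_words[OF assms groups] by auto
  then have "fp_class V G w = fp_class V G w'"
    using fp_class_eq_iff[OF groups] assms by blast
  then show ?thesis by (simp add: elt_def)
qed

lemma elt_eq_iff:
  assumes "w \<in> fp_words V G" "w' \<in> fp_words V G"
  shows "elt w = elt w' \<longleftrightarrow> fp_class V G w \<otimes>\<^bsub>FP\<^esub> inv\<^bsub>FP\<^esub> (fp_class V G w') \<in> K"
proof -
  note c = fp_class_closed[OF assms(1)] fp_class_closed[OF assms(2)]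
  have "elt w = elt w' \<longleftrightarrow> fp_class V G w \<in> K #>\<^bsub>FP\<^esub> fp_class V G w'"
    unfolding elt_def
    using group.repr_independence[OF group_FP _ c(2) kernel_subgroup]
      group.rcos_self[OF group_FP c(1) kernel_subgroup] by metis
  also have "\<dots> \<longleftrightarrow> fp_class V G w \<otimes>\<^bsub>FP\<^esub> inv\<^bsub>FP\<^esub> (fp_class V G w') \<in> K"
    by (rule subgroup.rcos_module[OF kernel_subgroup group_FP c(2) c(1)])
  finally show ?thesis .
qed

lemma relators_kernel: "periagroup_relators V E lab G \<subseteq> K"
  by (simp add: periagroup_kernel_def normal_closure_def hull_subset)

lemma elt_braid:
  assumes "{u, v} \<in> E" "a \<in> carrier (G u) - {\<one>\<^bsub>G u\<^esub>}" "b \<in> carrier (G v) - {\<one>\<^bsub>G v\<^esub>}"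
  shows "elt (alternating (lab {u, v}) (u, a) (v, b)) = elt (alternating (lab {u, v}) (v, b) (u, a))"
proof -
  have "alternating (lab {u, v}) (u, a) (v, b) \<in> fp_words V G"
    "alternating (lab {u, v}) (v, b) (u, a) \<in> fp_words V G"
    using alternating_words[of u v a b] alternating_words[of v u b a] assms
    by (auto simp: insert_commute)
  moreover have "fp_class V G (alternating (lab {u, v}) (u, a) (v, b)) \<otimes>\<^bsub>FP\<^esub>
      inv\<^bsub>FP\<^esub> (fp_class V G (alternating (lab {u, v}) (v, b) (u, a))) \<in> periagroup_relators V E lab G"
    using assms unfolding periagroup_relators_def by blast
  ultimately show ?thesis using relators_kernel elt_eq_iff by blast
qed

text \<open>The universal property of the presentation, phrased for relations on words: a congruence
  that contains the defining relations contains equality in the periagroup. The classes of words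
  related to the empty word form a normal subgroup containing the relators, hence the
  kernel.\<close>

lemma elt_eq_imp_cong:
  fixes R :: "('v \<times> 'a) list \<Rightarrow> ('v \<times> 'a) list \<Rightarrow> bool"
  assumes R_refl: "\<And>w. w \<in> fp_words V G \<Longrightarrow> R w w"
    and R_sym: "\<And>w w'. R w w' \<Longrightarrow> R w' w"
    and R_trans: "\<And>w w' w''. R w w' \<Longrightarrow> R w' w'' \<Longrightarrow> R w w''"
    and R_append: "\<And>x x' y y'. R x x' \<Longrightarrow> R y y' \<Longrightarrow> R (x @ y) (x' @ y')"
    and R_mult: "\<And>u a b. \<lbrakk>u \<in> V; a \<in> carrier (G u); b \<in> carrier (G u)\<rbrakk>
      \<Longrightarrow> R [(u, a), (u, b)] [(u, a \<otimes>\<^bsub>G u\<^esub> b)]"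
    and R_one: "\<And>u. u \<in> V \<Longrightarrow> R [(u, \<one>\<^bsub>G u\<^esub>)] []"
    and R_braid: "\<And>u v a b. \<lbrakk>{u, v} \<in> E; a \<in> carrier (G u) - {\<one>\<^bsub>G u\<^esub>};
      b \<in> carrier (G v) - {\<one>\<^bsub>G v\<^esub>}\<rbrakk>
      \<Longrightarrow> R (alternating (lab {u, v}) (u, a) (v, b)) (alternating (lab {u, v}) (v, b) (u, a))"
    and w: "w \<in> fp_words V G" "w' \<in> fp_words V G" "elt w = elt w'"
  shows "R w w'"
proof -
  interpret F: group FP by (rule group_FP)
  note cl = fp_class_closed and fpm = fp_mult[OF groups]
  have fp: "R x y" if "fp_eq V G x y" for x y
    using that
  proof (induction rule: fp_eq.induct)
    case (mult x y u a b)
    then show ?case by (intro R_append R_refl R_mult)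
  next
    case (one x y u)
    then show ?case using R_append[OF R_refl[of x] R_append[OF R_one[of u] R_refl[of y]]] by simp
  qed (use R_refl R_sym R_trans in blast)+
  define M where "M = {fp_class V G x | x. x \<in> fp_words V G \<and> R x []}"
  \<comment> \<open>Since \<open>R\<close> contains \<open>fp_eq\<close>, membership in
    \<open>M\<close> does not depend on the word representing a class.\<close>
  have M_iff: "fp_class V G x \<in> M \<longleftrightarrow> R x []" if "x \<in> fp_words V G" for x
    using that fp R_trans fp_class_eq_iff[OF groups] unfolding M_def by blast
  have "subgroup M FP"
  proof (rule F.subgroupI)
    show "M \<subseteq> carrier FP" using cl by (auto simp: M_def)
    show "M \<noteq> {}" using M_iff[OF Nil_words] R_refl[OF Nil_words] by blast
  next
    fix g assume "g \<in> M"
    then obtain x where x: "x \<in> fp_words V G" "R x []" "g = fp_class V G x" by (auto simp: M_def)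
    obtain x' where x': "x' \<in> fp_words V G" "inv\<^bsub>FP\<^esub> (fp_class V G x) = fp_class V G x'"
      "fp_eq V G (x' @ x) []" using fp_class_inv[OF x(1)] by metis
    have "R x' (x' @ x)"
      using R_append[OF R_refl[OF x'(1)] R_sym[OF x(2)]] by simp
    then show "inv\<^bsub>FP\<^esub> g \<in> M" using x x' M_iff fp R_trans by metis
  next
    fix g h assume "g \<in> M" "h \<in> M"
    then obtain x y where xy: "x \<in> fp_words V G" "R x []" "g = fp_class V G x"
      "y \<in> fp_words V G" "R y []" "h = fp_class V G y" by (auto simp: M_def)
    then show "g \<otimes>\<^bsub>FP\<^esub> h \<in> M"
      using R_append[OF xy(2,5)] M_iff[of "x @ y"] by (simp add: fpm)
  qed
  moreover have "g \<otimes>\<^bsub>FP\<^esub> h \<otimes>\<^bsub>FP\<^esub> inv\<^bsub>FP\<^esub> g \<in> M" if gh: "g \<in> carrier FP" "h \<in> M" for g h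
  proof -
    obtain x where x: "x \<in> fp_words V G" "R x []" "h = fp_class V G x"
      using gh by (auto simp: M_def)
    obtain y where y: "y \<in> fp_words V G" "g = fp_class V G y"
      using gh by (auto simp: fp_carrier[OF groups])
    obtain y' where y': "y' \<in> fp_words V G" "inv\<^bsub>FP\<^esub> (fp_class V G y) = fp_class V G y'"
      "fp_eq V G (y @ y') []" using fp_class_inv[OF y(1)] by metis
    have "R (y @ x @ y') (y @ [] @ y')"
      using x y y' by (intro R_append R_refl)
    then have "R (y @ x @ y') []" using fp[OF y'(3)] R_trans by simp
    then show ?thesis using M_iff[of "y @ x @ y'"] x y y' by (simp add: fpm)
  qed
  ultimately have "M \<lhd> FP" by (simp add: F.normal_inv_iff)
  \<comment> \<open>Translates relatedness of two words into membership of their quotient in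
    \<open>M\<close>, to match \<open>elt_eq_iff\<close>.\<close>
  moreover have diff: "fp_class V G x \<otimes>\<^bsub>FP\<^esub> inv\<^bsub>FP\<^esub> (fp_class V G y) \<in> M \<longleftrightarrow> R x y"
    if xy: "x \<in> fp_words V G" "y \<in> fp_words V G" for x y
  proof -
    obtain y' where y': "y' \<in> fp_words V G" "inv\<^bsub>FP\<^esub> (fp_class V G y) = fp_class V G y'"
      "fp_eq V G (y @ y') []" "fp_eq V G (y' @ y) []" using fp_class_inv[OF xy(2)] by metis
    have "fp_class V G x \<otimes>\<^bsub>FP\<^esub> inv\<^bsub>FP\<^esub> (fp_class V G y) \<in> M \<longleftrightarrow> R (x @ y') []"
      using M_iff[of "x @ y'"] xy y' by (simp add: fpm)
    also have "\<dots> \<longleftrightarrow> R x y"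
    proof
      assume "R x y"
      then show "R (x @ y') []"
        using R_append[OF _ R_refl[OF y'(1)]] fp[OF y'(3)] R_trans by blast
    next
      assume R: "R (x @ y') []"
      have "R x (x @ y' @ y)" using R_append[OF R_refl[OF xy(1)] R_sym[OF fp[OF y'(4)]]] by simp
      moreover have "R (x @ y' @ y) y" using R_append[OF R R_refl[OF xy(2)]] by simp
      ultimately show "R x y" by (rule R_trans)
    qed
    finally show ?thesis .
  qed
  moreover have "periagroup_relators V E lab G \<subseteq> M"
  proof
    fix g assume "g \<in> periagroup_relators V E lab G"
    then obtain u v a b where g: "{u, v} \<in> E" "a \<in> carrier (G u) - {\<one>\<^bsub>G u\<^esub>}"
      "b \<in> carrier (G v) - {\<one>\<^bsub>G v\<^esub>}"
      "g = fp_class V G (alternating (lab {u, v}) (u, a) (v, b)) \<otimes>\<^bsub>FP\<^esub>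
        inv\<^bsub>FP\<^esub> (fp_class V G (alternating (lab {u, v}) (v, b) (u, a)))"
      unfolding periagroup_relators_def by blast
    have "alternating (lab {u, v}) (u, a) (v, b) \<in> fp_words V G"
      "alternating (lab {u, v}) (v, b) (u, a) \<in> fp_words V G"
      using alternating_words[of u v a b] alternating_words[of v u b a] g
      by (auto simp: insert_commute)
    then show "g \<in> M" using diff R_braid g by simp
  qed
  ultimately have "K \<subseteq> M"
    unfolding periagroup_kernel_def normal_closure_def by (intro hull_minimal)
  then show ?thesis using w elt_eq_iff diff by blast
qed

section \<open>The periagroup as an instance, and its parabolic subgroups\<close>

lemma vertex_elem_elt: "vertex_elem V E lab G u a = elt [(u, a)]"
  by (simp add: vertex_elem_def elt_def)

lemma foldr_vertex_elem:
  "w \<in> fp_words V G \<Longrightarrow> foldr (\<lambda>(u, a) x. vertex_elem V E lab G u a \<otimes>\<^bsub>PG\<^esub> x) w \<one>\<^bsub>PG\<^esub> = elt w"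
proof (induction w)
  case (Cons l w)
  then have "[l] \<in> fp_words V G" "w \<in> fp_words V G" by (auto simp: fp_words_def)
  then show ?case using Cons.IH elt_append[of "[l]" w] by (cases l) (simp add: vertex_elem_elt)
qed (simp add: elt_Nil)

lemma periagroup_rep: "periagroup_rep V E lab G PG (vertex_elem V E lab G)"
proof (intro periagroup_rep.intro periagroup_rep_axioms.intro periagroup_data_axioms
    group_periagroup)
  fix u assume u: "u \<in> V"
  show "vertex_elem V E lab G u \<in> hom (G u) PG"
  proof (rule homI)
    fix a b assume ab: "a \<in> carrier (G u)" "b \<in> carrier (G u)"
    have "fp_eq V G [(u, a), (u, b)] [(u, a \<otimes>\<^bsub>G u\<^esub> b)]"
      using fp_eq.mult[OF Nil_words Nil_words u ab] by simp
    then have "elt [(u, a \<otimes>\<^bsub>G u\<^esub> b)] = elt ([(u, a)] @ [(u, b)])"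
      using elt_cong by simp
    also have "\<dots> = elt [(u, a)] \<otimes>\<^bsub>PG\<^esub> elt [(u, b)]"
      using u ab by (intro elt_append) (auto simp: fp_words_def)
    finally show "vertex_elem V E lab G u (a \<otimes>\<^bsub>G u\<^esub> b) =
        vertex_elem V E lab G u a \<otimes>\<^bsub>PG\<^esub> vertex_elem V E lab G u b"
      by (simp add: vertex_elem_elt)
  qed (rule vertex_elem_closed[OF u])
next
  fix u v a b
  assume uv: "{u, v} \<in> E" "a \<in> carrier (G u) - {\<one>\<^bsub>G u\<^esub>}" "b \<in> carrier (G v) - {\<one>\<^bsub>G v\<^esub>}"
  then have "alternating (lab {u, v}) (u, a) (v, b) \<in> fp_words V G"
    "alternating (lab {u, v}) (v, b) (u, a) \<in> fp_words V G"
    using alternating_words[of u v a b] alternating_words[of v u b a]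
    by (auto simp: insert_commute)
  then show "foldr (\<lambda>(u, a) x. vertex_elem V E lab G u a \<otimes>\<^bsub>PG\<^esub> x)
        (alternating (lab {u, v}) (u, a) (v, b)) \<one>\<^bsub>PG\<^esub> =
      foldr (\<lambda>(u, a) x. vertex_elem V E lab G u a \<otimes>\<^bsub>PG\<^esub> x)
        (alternating (lab {u, v}) (v, b) (u, a)) \<one>\<^bsub>PG\<^esub>"
    using elt_braid[OF uv] by (simp add: foldr_vertex_elem)
qed

theorem parabolic_Int:
  assumes "parabolic V E lab G A" "parabolic V E lab G B"
  shows "parabolic V E lab G (A \<inter> B)"
proof -
  interpret R: periagroup_rep V E lab G PG "vertex_elem V E lab G" by (rule periagroup_rep)
  have val: "R.word_val w = elt w" if "w \<in> fp_words V G" for w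
    using that by (simp add: R.word_val_def foldr_vertex_elem)
  \<comment> \<open>The invariance lemmas make \<open>word_cong\<close> a congruence containing the
    defining relations, so words of equal value in the periagroup are congruent.\<close>
  have cong: "R.word_cong w w'"
    if "w \<in> fp_words V G" "w' \<in> fp_words V G" "R.word_val w = R.word_val w'" for w w'
  proof -
    have "elt w = elt w'" using that val by simp
    with R.word_cong_refl R.word_cong_sym R.word_cong_trans R.word_cong_append R.word_cong_mult
      R.word_cong_one R.word_cong_braid that(1,2)
    show ?thesis by (intro elt_eq_imp_cong[of R.word_cong w w'])
  qed
  have "carrier PG = R.word_val ` fp_words V G"
    using carrier_PG val by simp
  then interpret C: wall_cocycle PG V R.S
    "\<lambda>g. R.displ (SOME w. w \<in> fp_words V G \<and> R.word_val w = g)"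
    using cong by (rule R.wall_cocycle_displ)
  have span: "vertices_subgroup V E lab G W = C.span W" for W
    by (simp add: vertices_subgroup_def C.span_def R.S_def)
  have conj: "g <#\<^bsub>PG\<^esub> (C.span W #>\<^bsub>PG\<^esub> inv\<^bsub>PG\<^esub> g) = R.conj_set g (C.span W)"
    if "g \<in> carrier PG" "W \<subseteq> V" for g W
    by (rule R.conj_set_eq_cosets[OF that(1) C.span_subset[OF that(2)]])
  \<comment> \<open>The edgeless graph on \<open>W\<close> is the witness when a conjugate of a span
    is to be recognised as parabolic.\<close>
  have sub: "subgraph W {} V E" if "W \<subseteq> V" for W
    using that by (simp add: subgraph_def simplicial_graph_def)
  have parabolic: "parabolic V E lab G M \<longleftrightarrow>
      (\<exists>W\<subseteq>V. \<exists>g\<in>carrier PG. M = R.conj_set g (C.span W))" for M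
  proof
    assume "parabolic V E lab G M"
    then obtain W F g where W: "subgraph W F V E" and g: "g \<in> carrier PG"
      and M: "M = g <#\<^bsub>PG\<^esub> (C.span W #>\<^bsub>PG\<^esub> inv\<^bsub>PG\<^esub> g)"
      unfolding parabolic_def span by blast
    from W have "W \<subseteq> V" by (simp add: subgraph_def)
    then show "\<exists>W\<subseteq>V. \<exists>g\<in>carrier PG. M = R.conj_set g (C.span W)" using M g conj by metis
  next
    assume "\<exists>W\<subseteq>V. \<exists>g\<in>carrier PG. M = R.conj_set g (C.span W)"
    then show "parabolic V E lab G M" unfolding parabolic_def span using conj sub by metis
  qed
  from assms show ?thesis
    unfolding parabolic using C.conjugate_span_Int by metis
qed

end

theorem theorem1p7:
  fixes V :: "'v set" and E :: "'v set set" and lab :: "'v set \<Rightarrow> nat"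
    and G :: "'v \<Rightarrow> ('a, 'b) monoid_scheme"
    and H K :: "('v \<times> 'a) list set set set"
  assumes "periagroup_data V E lab G"
    and "parabolic V E lab G H"
    and "parabolic V E lab G K"
  shows "parabolic V E lab G (H \<inter> K)"
  using assms by (rule periagroup_data.parabolic_Int)

end
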